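(* Let $\mathcal{X}$ be a real Banach space. A function $g:[a,b]\to\mathcal{X}^*$ is Henstock–Gel'fand integrable on $[a,b]$ if and only if $yg$ is Henstock integrable on $[a,b]$ for every $y\in\mathcal{X}$.
   Context: For $y\in\mathcal{X}$, $yg$ denotes $t\mapsto g(t)(y)$. A function $h:[a,b]\to\mathbb{R}$ is Henstock integrable on $[a,b]$ if there is $A\in\mathbb{R}$ such that for every $\epsilon>0$ there is a gauge $\delta:[a,b]\to(0,\infty)$ such that for every tagged partition $\{([u_k,z_k],t_k)\}_{k=1}^n$ of $[a,b]$ with $t_k\in[u_k,z_k]\subset(t_k-\delta(t_k),t_k+\delta(t_k))$ one has $|\sum_k h(t_k)(z_k-u_k)-A|<\epsilon$; $A=\mathcal{H}\int_a^b h$, and similarly on subintervals. A function $g:[a,b]\to\mathcal{X}^*$ is Henstock–Gel'fand integrable on $[a,b]$ if $yg$ is Henstock integrable on $[a,b]$ for each $y\in\mathcal{X}$ and for every interval $I\subset[a,b]$ there is $y_I^*\in\mathcal{X}^*$ with $y_I^*(y)=\mathcal{H}\int_I yg$ for all $y\in\mathcal{X}$. *)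

theory Defs
  imports "HOL-Analysis.Analysis"
begin

(* X* = bounded linear functionals; yg = (%t. blinfun_apply (g t) y); Henstock integral = gauge integral. *)

definition henstock_gelfand_integrable ::
  "(real \<Rightarrow> ('a::banach \<Rightarrow>\<^sub>L real)) \<Rightarrow> real \<Rightarrow> real \<Rightarrow> bool" where
  "henstock_gelfand_integrable g a b \<longleftrightarrow>
     (\<forall>y. (\<lambda>t. blinfun_apply (g t) y) integrable_on {a..b}) \<and>
     (\<forall>c d. {c..d} \<subseteq> {a..b} \<longrightarrow>
        (\<exists>yI :: 'a \<Rightarrow>\<^sub>L real. \<forall>y. blinfun_apply yI y = integral {c..d} (\<lambda>t. blinfun_apply (g t) y)))"

end

theory Submission
  imports Defs
begin

text \<open>
  Call a point bad if on no neighbourhood of it all the functionals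
  \<open>y \<mapsto> \<integral>\<^sub>c\<^sup>d g(t)(y) dt\<close> are bounded, and suppose that the closed set \<open>P\<close> of bad points is not empty.
  For a fixed \<open>y\<close>, the Baire category theorem on \<open>P\<close>, applied to the sets where a Henstock gauge of \<open>yg\<close>
  is at least \<open>1/n\<close> and \<open>|yg| \<le> n\<close>, yields a rational interval \<open>(\<alpha>, \<beta>)\<close> that meets \<open>P\<close> and on
  which the primitive of \<open>yg\<close> has bounded variation with respect to intervals having an endpoint in \<open>P\<close>.
  Consequently \<open>yg\<close> is Lebesgue integrable on \<open>P \<inter> [\<alpha>, \<beta>]\<close> and its oscillations over the gaps of \<open>P\<close>
  are summable. By Fatou's lemma and the boundedness of the functionals inside the gaps, bounds on
  these two quantities define closed sets of \<open>y\<close>; countably many of them cover the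
  Banach space, so one has interior points. By Harnack's extension theorem the integral over any
  subinterval of \<open>[\<alpha>, \<beta>]\<close> is the integral over \<open>P\<close> plus the sum over the gaps, hence it is a bounded
  functional of \<open>y\<close>, contradicting the badness of the points of \<open>P \<inter> (\<alpha>, \<beta>)\<close>.
\<close>

section \<open>Harnack's extension theorem\<close>

text \<open>Clipping with \<open>max\<close> and \<open>min\<close> covers every relative position
  of the two intervals. On \<open>{p..q}\<close> the restrictions to the given and to the clipped
  open interval differ at most at \<open>p\<close> and \<open>q\<close>; if the clipped interval is
  empty, both sides vanish.\<close>

lemma has_integral_restrict_open_interval:
  fixes f :: "real \<Rightarrow> real"
  assumes f: "\<And>a b. f integrable_on {a..b}"
  shows "((\<lambda>x. if x \<in> {l<..<r} then f x else 0) has_integral integral {max l p..min r q} f) {p..q}"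
proof (cases "max l p \<le> min r q")
  case True
  have "((\<lambda>x. if x \<in> box (max l p) (min r q) then f x else 0) has_integral
      integral {max l p..min r q} f) (cbox p q)"
    using f by (intro has_integral_restrict_open_subinterval) (auto simp: integrable_integral)
  then show ?thesis
    unfolding box_real
    by (rule has_integral_spike_finite[where S = "{p, q}", rotated 2]) auto
next
  case False
  then have "((\<lambda>x. if x \<in> {l<..<r} then f x else 0) has_integral 0) {p..q}"
    by (intro has_integral_is_0) (auto simp: max_def min_def split: if_splits)
  with False show ?thesis by simp
qed

lemma sum_at_most_one_nonzero_le:
  fixes h :: "'a \<Rightarrow> real"
  assumes "\<And>i j. i \<in> A \<Longrightarrow> j \<in> A \<Longrightarrow> h i \<noteq> 0 \<Longrightarrow> h j \<noteq> 0 \<Longrightarrow> i = j"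
    and "\<And>i. i \<in> A \<Longrightarrow> h i \<le> B" "0 \<le> B"
  shows "sum h A \<le> B"
proof (cases "\<exists>i\<in>A. h i \<noteq> 0")
  case True
  then obtain i where i: "i \<in> A" "h i \<noteq> 0" by blast
  show ?thesis
  proof (cases "finite A")
    case True
    have "sum h A = sum h {i}"
      using True i assms(1) by (intro sum.mono_neutral_right) auto
    then show ?thesis using assms i by simp
  qed (use assms in simp)
next
  case False
  then have "sum h A = 0" by (intro sum.neutral) blast
  then show ?thesis using assms by simp
qed

text \<open>Tags outside the open interval lie to one side of it; on each side, at most one interval of the
division can reach into it.\<close>

lemma sum_integral_tags_outside_open_interval_le:
  fixes f :: "real \<Rightarrow> real" and l r :: real
  defines "k \<equiv> \<lambda>x. if x \<in> {l<..<r} then f x else 0"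
  assumes D: "D tagged_partial_division_of {c..d}"
    and out: "\<And>x K. (x, K) \<in> D \<Longrightarrow> x \<notin> {l<..<r}"
    and B: "\<And>p q. \<bar>integral {p..q} k\<bar> \<le> B"
  shows "(\<Sum>(x, K)\<in>D. \<bar>integral K k\<bar>) \<le> 2 * B"
proof -
  have B0: "0 \<le> B" using B[of 0 0] by simp
  note D' = tagged_partial_division_ofD[OF D]
  have le: "\<bar>integral K k\<bar> \<le> B" if "(x, K) \<in> D" for x K
    using D'(4)[OF that] B by auto
  \<comment> \<open>If no point strictly inside \<open>K\<close> lies in the open interval, then
    \<open>k\<close> vanishes on \<open>K\<close> except possibly at the two ends.\<close>
  have meet: "\<exists>p q z. K = {p..q} \<and> p \<le> x \<and> x \<le> q \<and> p < z \<and> z < q \<and> l < z \<and> z < r"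
    if xK: "(x, K) \<in> D" and n0: "integral K k \<noteq> 0" for x K
  proof -
    obtain p q where pq: "K = {p..q}" using D'(4)[OF xK] box_real(2) by metis
    have "\<exists>z. p < z \<and> z < q \<and> l < z \<and> z < r"
    proof (rule ccontr)
      assume no: "\<not> ?thesis"
      have "(k has_integral 0) {p..q}"
        by (rule has_integral_spike_finite[where S = "{p, q}" and f = "\<lambda>_. 0"])
          (use no in \<open>auto simp: k_def not_le dest: leD\<close>)
      then show False using n0 pq by (auto dest: integral_unique)
    qed
    then show ?thesis using pq D'(2)[OF xK] by auto
  qed
  define L where "L = {(x, K) \<in> D. x \<le> l}"
  have fin: "finite D" by (rule D')
  have uniq: "i = j" if "i \<in> D" "j \<in> D" "z \<in> interior (snd i)" "z \<in> interior (snd j)" for i j z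
  proof (rule ccontr)
    assume "i \<noteq> j"
    then have "interior (snd i) \<inter> interior (snd j) = {}"
      using D'(5)[of "fst i" "snd i" "fst j" "snd j"] that by simp
    then show False using that by blast
  qed
  have "(\<Sum>i\<in>L. \<bar>integral (snd i) k\<bar>) \<le> B"
  proof (rule sum_at_most_one_nonzero_le)
    fix i j assume ij: "i \<in> L" "j \<in> L" "\<bar>integral (snd i) k\<bar> \<noteq> 0" "\<bar>integral (snd j) k\<bar> \<noteq> 0"
    then obtain x K x' K' where e: "i = (x, K)" "j = (x', K')" "x \<le> l" "x' \<le> l" "(x, K) \<in> D" "(x', K') \<in> D"
      by (cases i; cases j) (auto simp: L_def)
    obtain p q z where z: "K = {p..q} \<and> p \<le> x \<and> x \<le> q \<and> p < z \<and> z < q \<and> l < z \<and> z < r"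
      using meet[of x K] e ij by auto
    obtain p' q' z' where z': "K' = {p'..q'} \<and> p' \<le> x' \<and> x' \<le> q' \<and> p' < z' \<and> z' < q' \<and> l < z' \<and> z' < r"
      using meet[of x' K'] e ij by auto
    \<comment> \<open>Both intervals start at or before \<open>l\<close> and extend beyond
      \<open>min z z'\<close>, which is therefore interior to both.\<close>
    show "i = j"
      by (rule uniq[of _ _ "min z z'"]) (use e z z' in auto)
  qed (use le B0 in \<open>auto simp: L_def\<close>)
  moreover have "(\<Sum>i\<in>D - L. \<bar>integral (snd i) k\<bar>) \<le> B"
  proof (rule sum_at_most_one_nonzero_le)
    fix i j assume ij: "i \<in> D - L" "j \<in> D - L" "\<bar>integral (snd i) k\<bar> \<noteq> 0" "\<bar>integral (snd j) k\<bar> \<noteq> 0"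
    then obtain x K x' K' where e: "i = (x, K)" "j = (x', K')" "x \<ge> r" "x' \<ge> r" "(x, K) \<in> D" "(x', K') \<in> D"
      using out by (cases i; cases j) (fastforce simp: L_def)
    obtain p q z where z: "K = {p..q} \<and> p \<le> x \<and> x \<le> q \<and> p < z \<and> z < q \<and> l < z \<and> z < r"
      using meet[of x K] e ij by auto
    obtain p' q' z' where z': "K' = {p'..q'} \<and> p' \<le> x' \<and> x' \<le> q' \<and> p' < z' \<and> z' < q' \<and> l < z' \<and> z' < r"
      using meet[of x' K'] e ij by auto
    show "i = j"
      by (rule uniq[of _ _ "max z z'"]) (use e z z' in auto)
  qed (use le B0 in auto)
  moreover have "(\<Sum>(x, K)\<in>D. \<bar>integral K k\<bar>) =
      (\<Sum>i\<in>L. \<bar>integral (snd i) k\<bar>) + (\<Sum>i\<in>D - L. \<bar>integral (snd i) k\<bar>)"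
    using fin by (subst sum.subset_diff[of L]) (auto simp: L_def case_prod_beta)
  ultimately show ?thesis by simp
qed

text \<open>The gauge confines an interval tagged in a gap to that gap and obeys its Henstock gauge;
  at all other points it obeys the gauges of the first \<open>N\<close> gaps at once. Tags outside
  the gaps then disturb a later gap \<open>m\<close> only through at most one interval on each side,
  at a cost of \<open>2 * B m\<close>, and the tail of \<open>B\<close> is small.\<close>

lemma has_integral_disjoint_open_intervals:
  fixes f :: "real \<Rightarrow> real" and l r B :: "nat \<Rightarrow> real"
  assumes f: "\<And>a b. f integrable_on {a..b}"
    and disj: "disjoint_family (\<lambda>m. {l m<..<r m})"
    and B: "\<And>m x y. l m \<le> x \<Longrightarrow> y \<le> r m \<Longrightarrow> \<bar>integral {x..y} f\<bar> \<le> B m"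
    and sB: "summable B"
  shows "((\<lambda>x. if x \<in> (\<Union>m. {l m<..<r m}) then f x else 0) has_integral
           (\<Sum>m. integral {max (l m) c..min (r m) d} f)) {c..d}"
proof -
  define G where "G m = {l m<..<r m}" for m
  define k where "k m x = (if x \<in> G m then f x else 0)" for m x
  define J where "J m = integral {max (l m) c..min (r m) d} f" for m
  let ?k = "\<lambda>x. if x \<in> (\<Union>m. G m) then f x else 0"
  have uniqG: "m = n" if "x \<in> G m" "x \<in> G n" for x m n
    using disj that unfolding disjoint_family_on_def G_def by blast
  have kint: "(k m has_integral integral {max (l m) p..min (r m) q} f) {p..q}" for m p q
    using has_integral_restrict_open_interval[OF f, of "l m" "r m" p q] by (simp add: k_def[abs_def] G_def)
  have kI: "k m integrable_on {p..q}" "integral {p..q} (k m) = integral {max (l m) p..min (r m) q} f" for m p q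
    using kint by (auto simp: has_integral_iff)
  have kB: "\<bar>integral {p..q} (k m)\<bar> \<le> B m" for m p q
    unfolding kI by (rule B) auto
  have JB: "\<bar>J m\<bar> \<le> B m" for m using kB[of c d m] by (simp add: kI J_def)
  have sJ: "summable J"
    by (rule summable_comparison_test[OF _ sB]) (use JB in auto)
  have "(?k has_integral suminf J) (cbox c d)"
    unfolding has_integral
  proof (intro allI impI)
    fix e :: real assume e: "0 < e"
    \<comment> \<open>The tail enters with factor 2 and so costs \<open>e / 4\<close>; the Henstock
      errors \<open>\<epsilon> m\<close> sum to another \<open>e / 4\<close>.\<close>
    obtain N where N: "norm (\<Sum>i. B (i + N)) < e / 8"
      using suminf_exist_split[OF _ sB, of "e / 8"] e by auto
    define \<epsilon> where "\<epsilon> m = e / 4 * (1 / 2) ^ Suc m" for m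
    have \<epsilon>0: "0 < \<epsilon> m" for m using e by (simp add: \<epsilon>_def)
    have \<epsilon>sums: "\<epsilon> sums (e / 4)"
      unfolding \<epsilon>_def using sums_mult[OF power_half_series, of "e / 4"] by simp
    define H where "H m \<gamma> \<longleftrightarrow> gauge \<gamma> \<and> (\<forall>p. p tagged_partial_division_of cbox c d \<longrightarrow> \<gamma> fine p \<longrightarrow>
        (\<Sum>(x, K)\<in>p. norm (measure lborel K *\<^sub>R k m x - integral K (k m))) < \<epsilon> m)" for m \<gamma>
    have "\<exists>\<gamma>. H m \<gamma>" for m
    proof -
      have "k m integrable_on cbox c d" using kI by simp
      then show ?thesis
        by (rule Henstock_lemma[OF _ \<epsilon>0[of m]]) (unfold H_def, intro exI conjI allI impI)
    qed
    then obtain \<gamma> where H: "\<And>m. H m (\<gamma> m)" by metis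
    have \<gamma>: "gauge (\<gamma> m)" for m using H by (simp add: H_def)
    have hen: "(\<Sum>(x, K)\<in>p. norm (measure lborel K *\<^sub>R k m x - integral K (k m))) < \<epsilon> m"
      if "p tagged_partial_division_of cbox c d" "\<gamma> m fine p" for m p
      using H[of m] that unfolding H_def by blast
    \<comment> \<open>Outside the gaps only finitely many gauges are intersected, which keeps
      \<open>\<delta> x\<close> open.\<close>
    define \<delta> where "\<delta> x = (if x \<in> (\<Union>m. G m) then let m = (THE m. x \<in> G m) in \<gamma> m x \<inter> G m
        else (\<Inter>m<N. \<gamma> m x))" for x
    have \<delta>in: "\<delta> x = \<gamma> m x \<inter> G m" if "x \<in> G m" for x m
    proof -
      have "(THE m. x \<in> G m) = m" using that uniqG by blast
      then show ?thesis using that unfolding \<delta>_def Let_def by (metis UN_iff UNIV_I)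
    qed
    have \<delta>out: "\<delta> x = (\<Inter>m<N. \<gamma> m x)" if "x \<notin> (\<Union>m. G m)" for x
      using that by (simp add: \<delta>_def)
    show "\<exists>\<gamma>. gauge \<gamma> \<and> (\<forall>\<D>. \<D> tagged_division_of cbox c d \<and> \<gamma> fine \<D> \<longrightarrow>
        norm ((\<Sum>(x, K)\<in>\<D>. measure lborel K *\<^sub>R ?k x) - suminf J) < e)"
    proof (intro exI conjI allI impI)
      show "gauge \<delta>"
      proof (rule gaugeI)
        fix x
        show "x \<in> \<delta> x"
        proof (cases "x \<in> (\<Union>m. G m)")
          case True
          then obtain m where "x \<in> G m" by blast
          then show ?thesis using \<gamma>[of m] \<delta>in[of x m] by (auto simp: gauge_def)
        next
          case False
          then show ?thesis using \<gamma> \<delta>out[of x] by (auto simp: gauge_def)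
        qed
        show "open (\<delta> x)"
        proof (cases "x \<in> (\<Union>m. G m)")
          case True
          then obtain m where "x \<in> G m" by blast
          then show ?thesis using \<gamma>[of m] \<delta>in[of x m] by (auto simp: gauge_def G_def)
        next
          case False
          then show ?thesis using \<gamma> \<delta>out[of x] by (auto simp: gauge_def)
        qed
      qed
      fix D assume "D tagged_division_of cbox c d \<and> \<delta> fine D"
      then have D: "D tagged_division_of cbox c d" and fine: "\<delta> fine D" by auto
      have Dp: "D tagged_partial_division_of cbox c d"
        using D by (auto simp: tagged_division_of_def)
      have fin: "finite D" using D by auto
      define T where "T m i = measure lborel (snd i) * k m (fst i) - integral (snd i) (k m)" for m i
      have Tsum: "(\<Sum>i\<in>D. T m i) = (\<Sum>(x, K)\<in>D. measure lborel K * k m x) - J m" for m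
      proof -
        have "J m = (\<Sum>(x, K)\<in>D. integral K (k m))"
          using integral_combine_tagged_division_topdown[of "k m" c d D] D kI by (simp add: J_def)
        then show ?thesis by (simp add: T_def sum_subtractf case_prod_beta)
      qed
      have Tbound: "\<bar>\<Sum>i\<in>D. T m i\<bar> \<le> \<epsilon> m + (if m < N then 0 else 2 * B m)" for m
      proof -
        define D1 where "D1 = {i \<in> D. fst i \<in> G m}"
        define D2 where "D2 = {i \<in> D. fst i \<notin> (\<Union>m. G m)}"
        have sub: "D1 \<subseteq> D" "D2 \<subseteq> D" "D1 \<union> D2 \<subseteq> D" and dj: "D1 \<inter> D2 = {}"
          by (auto simp: D1_def D2_def)
        have fin12: "finite D1" "finite D2" using sub fin finite_subset by blast+
        \<comment> \<open>A tag in another gap \<open>G n\<close> keeps its whole interval inside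
          \<open>G n\<close>, where \<open>k m\<close> is zero.\<close>
        have other: "T m i = 0" if i: "i \<in> D - (D1 \<union> D2)" for i
        proof -
          obtain n where n: "fst i \<in> G n" "n \<noteq> m" using i by (auto simp: D1_def D2_def)
          have "snd i \<subseteq> \<delta> (fst i)" using fine i by (fastforce simp: fine_def)
          then have sG: "snd i \<subseteq> G n" using \<delta>in[OF n(1)] by auto
          have k0: "k m x = 0" if "x \<in> G n" for x using uniqG that n by (auto simp: k_def)
          have "integral (snd i) (k m) = integral (snd i) (\<lambda>_. 0)"
            using sG k0 by (intro integral_cong) auto
          then show ?thesis using k0 n by (simp add: T_def)
        qed
        have split: "(\<Sum>i\<in>D. T m i) = (\<Sum>i\<in>D1. T m i) + (\<Sum>i\<in>D2. T m i)"
          using fin sub dj other fin12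
          by (subst sum.mono_neutral_right[of D "D1 \<union> D2"]) (auto simp: sum.union_disjoint)
        have hen': "(\<Sum>i\<in>p. \<bar>T m i\<bar>) \<le> \<epsilon> m" if "p \<subseteq> D" "\<gamma> m fine p" for p
          using hen[of p m] tagged_partial_division_subset[OF Dp that(1)] that(2)
          by (simp add: T_def case_prod_beta)
        show ?thesis
        proof (cases "m < N")
          case True
          have "\<gamma> m fine (D1 \<union> D2)"
          proof (rule fineI)
            fix x K assume xK: "(x, K) \<in> D1 \<union> D2"
            then have "K \<subseteq> \<delta> x" using fine sub by (fastforce simp: fine_def)
            then show "K \<subseteq> \<gamma> m x"
              using xK True \<delta>in[of x m] \<delta>out[of x] by (auto simp: D1_def D2_def)
          qed
          then have "(\<Sum>i\<in>D1 \<union> D2. \<bar>T m i\<bar>) \<le> \<epsilon> m" using hen' sub by blast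
          then have "\<bar>\<Sum>i\<in>D1 \<union> D2. T m i\<bar> \<le> \<epsilon> m" using sum_abs order_trans by blast
          then show ?thesis using split True fin12 dj by (simp add: sum.union_disjoint)
        next
          case False
          have "\<gamma> m fine D1"
          proof (rule fineI)
            fix x K assume xK: "(x, K) \<in> D1"
            then have "K \<subseteq> \<delta> x" using fine sub by (fastforce simp: fine_def)
            then show "K \<subseteq> \<gamma> m x" using xK \<delta>in[of x m] by (auto simp: D1_def)
          qed
          then have "(\<Sum>i\<in>D1. \<bar>T m i\<bar>) \<le> \<epsilon> m" using hen' sub by blast
          then have 1: "\<bar>\<Sum>i\<in>D1. T m i\<bar> \<le> \<epsilon> m" using sum_abs order_trans by blast
          \<comment> \<open>For these \<open>m\<close>, intervals tagged outside the gaps need not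
            be fine for \<open>\<gamma> m\<close>. Since \<open>k m\<close> vanishes at such tags,
            their error is just the integral of \<open>k m\<close>.\<close>
          have out: "x \<notin> {l m<..<r m}" if "(x, K) \<in> D2" for x K
            using that by (auto simp: D2_def G_def)
          have keq: "k m = (\<lambda>x. if x \<in> {l m<..<r m} then f x else 0)"
            by (auto simp: k_def G_def)
          have "(\<Sum>(x, K)\<in>D2. \<bar>integral K (k m)\<bar>) \<le> 2 * B m"
            unfolding keq
            using tagged_partial_division_subset[OF Dp sub(2)] out kB[of _ _ m, unfolded keq]
            by (intro sum_integral_tags_outside_open_interval_le[where c = c and d = d]) auto
          moreover have "(\<Sum>i\<in>D2. \<bar>T m i\<bar>) = (\<Sum>(x, K)\<in>D2. \<bar>integral K (k m)\<bar>)"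
            by (intro sum.cong) (auto simp: T_def k_def D2_def)
          ultimately have "\<bar>\<Sum>i\<in>D2. T m i\<bar> \<le> 2 * B m" using sum_abs order_trans by metis
          then show ?thesis using split 1 False by simp
        qed
      qed
      have ksums: "(\<lambda>m. k m x) sums ?k x" for x
      proof (cases "x \<in> (\<Union>m. G m)")
        case True
        then obtain n where n: "x \<in> G n" by blast
        have "(\<lambda>m. k m x) = (\<lambda>m. if m = n then f x else 0)"
          using n uniqG by (auto simp: k_def)
        then show ?thesis using True sums_single[of n "\<lambda>_. f x"] by simp
      qed (simp add: k_def)
      have "(\<lambda>m. (\<Sum>(x, K)\<in>D. measure lborel K * k m x) - J m) sums ((\<Sum>(x, K)\<in>D. measure lborel K * ?k x) - suminf J)"
        unfolding case_prod_beta
        by (intro sums_diff sums_sum sums_mult ksums summable_sums sJ)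
      then have Ts: "(\<lambda>m. \<Sum>i\<in>D. T m i) sums ((\<Sum>(x, K)\<in>D. measure lborel K * ?k x) - suminf J)"
        by (simp add: Tsum)
      have tail: "(\<lambda>m. if m < N then 0 else 2 * B m) sums (2 * (\<Sum>i. B (i + N)))"
      proof -
        have "(\<lambda>i. 2 * B (i + N)) sums (2 * (\<Sum>i. B (i + N)))"
          by (intro sums_mult summable_sums summable_ignore_initial_segment sB)
        then have "(\<lambda>i. (if i + N < N then 0 else 2 * B (i + N))) sums (2 * (\<Sum>i. B (i + N)))"
          by simp
        then show ?thesis
          by (subst (asm) sums_iff_shift[where f = "\<lambda>m. if m < N then 0 else 2 * B m"]) simp
      qed
      have bs: "(\<lambda>m. \<epsilon> m + (if m < N then 0 else 2 * B m)) sums (e / 4 + 2 * (\<Sum>i. B (i + N)))"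
        by (intro sums_add \<epsilon>sums tail)
      have "norm (\<Sum>m. \<Sum>i\<in>D. T m i) \<le> (\<Sum>m. \<epsilon> m + (if m < N then 0 else 2 * B m))"
        using Tbound bs by (intro norm_suminf_le) (auto simp: sums_iff)
      then have "\<bar>(\<Sum>(x, K)\<in>D. measure lborel K * ?k x) - suminf J\<bar> \<le> e / 4 + 2 * (\<Sum>i. B (i + N))"
        using Ts bs by (simp add: sums_iff)
      also have "\<dots> < e" using N e by (auto simp: abs_less_iff)
      finally show "norm ((\<Sum>(x, K)\<in>D. measure lborel K *\<^sub>R ?k x) - suminf J) < e" by simp
    qed
  qed
  then show ?thesis by (simp add: G_def J_def[abs_def])
qed

section \<open>Variation over the gaps of a closed set\<close>

text \<open>Continuity of the indefinite integral carries the bound from closed intervals inside the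
  open interval to those touching its ends.\<close>

lemma abs_integral_le_closed_interval:
  fixes f :: "real \<Rightarrow> real"
  assumes f: "\<And>a b. f integrable_on {a..b}"
    and le: "\<And>c d. {c..d} \<subseteq> {l<..<r} \<Longrightarrow> \<bar>integral {c..d} f\<bar> \<le> B"
    and xy: "l \<le> x" "y \<le> r"
  shows "\<bar>integral {x..y} f\<bar> \<le> B"
proof (cases "x < y")
  case False
  then have "integral {x..y} f = 0" by (cases "x = y") auto
  \<comment> \<open>The interval \<open>{1..0}\<close> is empty, which forces
    \<open>0 \<le> B\<close>.\<close>
  then show ?thesis using le[of 1 0] by simp
next
  case True
  \<comment> \<open>The factor 1/3 keeps \<open>x + t n < y - t n\<close> for every
    \<open>n\<close>, and the shrunken intervals lie strictly between \<open>l\<close> and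
    \<open>r\<close>.\<close>
  define t where "t n = (y - x) / 3 * inverse (real (Suc n))" for n
  have t: "0 < t n" "2 * t n < y - x" for n
  proof -
    show "0 < t n" using True by (simp add: t_def)
    have "t n \<le> (y - x) / 3 * 1"
      unfolding t_def using True by (intro mult_left_mono) (auto simp: inverse_eq_divide)
    then show "2 * t n < y - x" using True by simp
  qed
  have t0: "t \<longlonglongrightarrow> 0" 
    unfolding t_def using tendsto_mult[OF tendsto_const LIMSEQ_inverse_real_of_nat, of "(y - x) / 3"] by simp
  have cont: "continuous_on {x..y} (\<lambda>z. integral {x..z} f)"
    by (rule indefinite_integral_continuous_1) (rule f)
  have "(\<lambda>n. integral {x..y - t n} f - integral {x..x + t n} f) \<longlonglongrightarrow> integral {x..y} f - integral {x..x} f"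
  proof (intro tendsto_diff)
    have a: "(\<lambda>n. y - t n) \<longlonglongrightarrow> y" using tendsto_diff[OF tendsto_const t0] by simp
    have b: "(\<lambda>n. x + t n) \<longlonglongrightarrow> x" using tendsto_add[OF tendsto_const t0] by simp
    have a': "\<forall>\<^sub>F n in sequentially. y - t n \<in> {x..y}"
      using t by (intro always_eventually allI) (auto intro: less_imp_le, smt (verit))
    have b': "\<forall>\<^sub>F n in sequentially. x + t n \<in> {x..y}"
      using t by (intro always_eventually allI) (auto intro: less_imp_le, smt (verit))
    show "(\<lambda>n. integral {x..y - t n} f) \<longlonglongrightarrow> integral {x..y} f"
      by (rule continuous_on_tendsto_compose[OF cont a _ a']) (use True in auto)
    show "(\<lambda>n. integral {x..x + t n} f) \<longlonglongrightarrow> integral {x..x} f"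
      by (rule continuous_on_tendsto_compose[OF cont b _ b']) (use True in auto)
  qed
  moreover have "integral {x..y - t n} f - integral {x..x + t n} f = integral {x + t n..y - t n} f" for n
    using Henstock_Kurzweil_Integration.integral_combine[of x "x + t n" "y - t n" f] t[of n] f by (auto simp: algebra_simps)
  ultimately have "(\<lambda>n. integral {x + t n..y - t n} f) \<longlonglongrightarrow> integral {x..y} f" by simp
  then have "(\<lambda>n. \<bar>integral {x + t n..y - t n} f\<bar>) \<longlonglongrightarrow> \<bar>integral {x..y} f\<bar>"
    by (rule tendsto_rabs)
  then show ?thesis
  proof (rule LIMSEQ_le_const2)
    have "\<bar>integral {x + t n..y - t n} f\<bar> \<le> B" for n
      using t(1)[of n] xy by (intro le) auto
    then show "\<exists>N. \<forall>n\<ge>N. \<bar>integral {x + t n..y - t n} f\<bar> \<le> B" by blast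
  qed
qed

text \<open>The connected components are open intervals, and their maximality keeps the endpoints
  out of \<open>U\<close>. They are numbered by an injection into the naturals; indices that name no
  component get an empty interval, whence the guard \<open>l m < r m\<close>.\<close>

lemma bounded_open_real_disjoint_intervals:
  fixes U :: "real set"
  assumes "open U" "bounded U"
  obtains l r :: "nat \<Rightarrow> real" where "disjoint_family (\<lambda>m. {l m<..<r m})"
    "U = (\<Union>m. {l m<..<r m})" "\<And>m. l m < r m \<Longrightarrow> l m \<notin> U \<and> r m \<notin> U"
proof -
  have C: "C = {Inf C<..<Sup C} \<and> Inf C \<notin> U \<and> Sup C \<notin> U" if C: "C \<in> components U" for C
  proof -
    have o: "open C" using C assms(1) open_components by blast
    have con: "connected C" and ne: "C \<noteq> {}" and sub: "C \<subseteq> U"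
      using C in_components_connected in_components_nonempty in_components_subset by blast+
    have b: "bounded C" using sub assms(2) bounded_subset by blast
    have bd: "bdd_above C" "bdd_below C" using b by (auto intro: bounded_imp_bdd_above bounded_imp_bdd_below)
    have nin: "Inf C \<notin> C" "Sup C \<notin> C"
    proof -
      have "Inf C - e \<in> C \<Longrightarrow> e > 0 \<Longrightarrow> False" for e using cInf_lower[OF _ bd(2), of "Inf C - e"] by simp
      moreover have "Sup C + e \<in> C \<Longrightarrow> e > 0 \<Longrightarrow> False" for e using cSup_upper[OF _ bd(1), of "Sup C + e"] by simp
      moreover have "\<exists>e>0. cball x e \<subseteq> C" if "x \<in> C" for x using o that open_contains_cball by blast
      moreover have "x - e \<in> cball x e \<and> x + e \<in> cball x e" if "e > 0" for x e :: real
        using that by (auto simp: dist_real_def)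
      ultimately show "Inf C \<notin> C" "Sup C \<notin> C" by blast+
    qed
    have cl: "x \<in> C" if "x \<in> U" "x \<in> closure C" for x
    proof -
      have "connected (insert x C)"
        by (rule connected_intermediate_closure[OF con]) (use that closure_subset in auto)
      then show ?thesis using components_maximal[OF C] that sub ne by blast
    qed
    have "Inf C \<in> closure C" "Sup C \<in> closure C"
      using closure_contains_Inf[OF ne bd(2)] closure_contains_Sup[OF ne bd(1)] by auto
    then have "Inf C \<notin> U \<and> Sup C \<notin> U" using nin cl by blast
    moreover have "C = {Inf C<..<Sup C}"
    proof (intro subset_antisym subsetI)
      fix x assume x: "x \<in> C"
      then have "Inf C \<le> x" "x \<le> Sup C" "x \<noteq> Inf C" "x \<noteq> Sup C"
        using nin cInf_lower[OF _ bd(2)] cSup_upper[OF _ bd(1)] by auto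
      then show "x \<in> {Inf C<..<Sup C}" by auto
    next
      fix x assume x: "x \<in> {Inf C<..<Sup C}"
      then obtain y z where "y \<in> C" "y < x" "z \<in> C" "x < z"
        using cInf_less_iff[OF ne bd(2)] less_cSup_iff[OF ne bd(1)] by auto
      then show "x \<in> C" using connectedD_interval[OF con, of y z x] by auto
    qed
    ultimately show ?thesis by blast
  qed
  have cnt: "countable (components U)"
    using assms(1) by (intro countable_disjoint_open_subsets)
      (use components_nonoverlap in \<open>auto simp: open_components pairwise_def disjnt_def\<close>)
  then obtain e :: "real set \<Rightarrow> nat" where e: "inj_on e (components U)" by (auto simp: countable_def)
  define g where "g m = inv_into (components U) e m" for m
  define l where "l m = (if m \<in> e ` components U then Inf (g m) else 0)" for m
  define r where "r m = (if m \<in> e ` components U then Sup (g m) else 0)" for m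
  have g: "g m \<in> components U" if "m \<in> e ` components U" for m
    using that by (simp add: g_def inv_into_into)
  have lr: "{l m<..<r m} = (if m \<in> e ` components U then g m else {})" for m
    using C[OF g[of m]] by (auto simp: l_def r_def)
  show thesis
  proof
    show "disjoint_family (\<lambda>m. {l m<..<r m})"
      unfolding disjoint_family_on_def
    proof (intro ballI impI)
      fix m n :: nat assume "m \<noteq> n"
      show "{l m<..<r m} \<inter> {l n<..<r n} = {}"
      proof (cases "m \<in> e ` components U \<and> n \<in> e ` components U")
        case True
        then have "g m \<noteq> g n" using \<open>m \<noteq> n\<close> unfolding g_def by (metis f_inv_into_f)
        then have "g m \<inter> g n = {}" using True g components_nonoverlap by blast
        then show ?thesis using True unfolding lr by simp
      next
        case False then show ?thesis unfolding lr by auto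
      qed
    qed
    have "(\<Union>m. {l m<..<r m}) = \<Union>(components U)"
    proof (intro subset_antisym subsetI)
      fix x assume "x \<in> (\<Union>m. {l m<..<r m})"
      then show "x \<in> \<Union>(components U)" unfolding lr using g by (auto split: if_splits simp del: Union_components)
    next
      fix x assume "x \<in> \<Union>(components U)"
      then obtain D where D: "D \<in> components U" "x \<in> D" by blast
      then have "g (e D) = D" using e by (simp add: g_def)
      then have "x \<in> {l (e D)<..<r (e D)}" unfolding lr using D by simp
      then show "x \<in> (\<Union>m. {l m<..<r m})" by blast
    qed
    then show "U = (\<Union>m. {l m<..<r m})" using Union_components by metis
    show "l m \<notin> U \<and> r m \<notin> U" if "l m < r m" for m
    proof -
      have "m \<in> e ` components U" using that by (auto simp: l_def r_def split: if_splits)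
      then show ?thesis using C[OF g] by (simp add: l_def r_def)
    qed
  qed
qed

text \<open>The chosen intervals are closed and lie inside the open gaps, where the integral
  functionals will already be known to be bounded; this makes the condition closed in
  \<open>y\<close>. An empty choice skips a gap.\<close>

definition gap_variation_le :: "(real \<Rightarrow> real) \<Rightarrow> (nat \<Rightarrow> real) \<Rightarrow> (nat \<Rightarrow> real) \<Rightarrow> real \<Rightarrow> bool" where
  "gap_variation_le f l r k \<longleftrightarrow>
     (\<forall>M c d. (\<forall>m<M. {c m..d m} \<subseteq> {l m<..<r m}) \<longrightarrow> (\<Sum>m<M. \<bar>integral {c m..d m} f\<bar>) \<le> k)"

text \<open>In each gap one interval is chosen whose absolute integral is at least half of the
  supremum. Taking \<open>B m\<close> as twice that value dominates the whole gap and keeps the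
  partial sums of \<open>B\<close> below \<open>2 * k\<close>.\<close>

lemma gap_variation_le_summable_bound:
  fixes f :: "real \<Rightarrow> real"
  assumes f: "\<And>a b. f integrable_on {a..b}" and k: "gap_variation_le f l r k"
  obtains B where "summable B" "suminf B \<le> 2 * k"
    "\<And>m x y. l m \<le> x \<Longrightarrow> y \<le> r m \<Longrightarrow> \<bar>integral {x..y} f\<bar> \<le> B m"
proof -
  have bd: "\<bar>integral {x..y} f\<bar> \<le> k" if "{x..y} \<subseteq> {l m<..<r m}" for m x y
  proof -
    \<comment> \<open>All gaps other than \<open>m\<close> receive the empty interval
      \<open>{1..0}\<close>.\<close>
    define c where "c n = (if n = m then x else 1)" for n
    define d where "d n = (if n = m then y else 0)" for n
    have "(\<Sum>n<Suc m. \<bar>integral {c n..d n} f\<bar>) \<le> k"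
      using k that unfolding gap_variation_le_def
      by (elim allE[of _ "Suc m"] allE[of _ c] allE[of _ d]) (auto simp: c_def d_def)
    moreover have "(\<Sum>n<m. \<bar>integral {c n..d n} f\<bar>) = 0"
      by (intro sum.neutral) (auto simp: c_def d_def)
    ultimately show ?thesis by (simp add: c_def d_def)
  qed
  have "\<exists>c d. {c..d} \<subseteq> {l m<..<r m} \<and>
      (\<forall>x y. {x..y} \<subseteq> {l m<..<r m} \<longrightarrow> \<bar>integral {x..y} f\<bar> \<le> 2 * \<bar>integral {c..d} f\<bar>)" for m
  proof -
    define A where "A = (\<lambda>(x, y). \<bar>integral {x..y} f\<bar>) ` {(x, y). {x..y} \<subseteq> {l m<..<r m}}"
    have bA: "bdd_above A" using bd by (intro bdd_aboveI[of _ k]) (auto simp: A_def)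
    have up: "\<bar>integral {x..y} f\<bar> \<le> Sup A" if "{x..y} \<subseteq> {l m<..<r m}" for x y
      using that by (intro cSup_upper bA) (auto simp: A_def intro!: image_eqI[of _ _ "(x, y)"])
    have 0: "{1..0::real} \<subseteq> {l m<..<r m}" by simp
    have ne: "A \<noteq> {}" using 0 unfolding A_def by blast
    show ?thesis
    proof (cases "Sup A \<le> 0")
      case True
      then have "\<bar>integral {x..y} f\<bar> \<le> 2 * \<bar>integral {1..0} f\<bar>" if "{x..y} \<subseteq> {l m<..<r m}" for x y
        using up[OF that] by simp
      then show ?thesis using 0 by blast
    next
      case False
      then have "Sup A / 2 < Sup A" by simp
      then obtain z where "z \<in> A" "Sup A / 2 < z" using less_cSup_iff[OF ne bA] by blast
      then obtain c d where cd: "{c..d} \<subseteq> {l m<..<r m}" "Sup A / 2 < \<bar>integral {c..d} f\<bar>"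
        by (auto simp: A_def)
      have "\<bar>integral {x..y} f\<bar> \<le> 2 * \<bar>integral {c..d} f\<bar>" if "{x..y} \<subseteq> {l m<..<r m}" for x y
        using up[OF that] cd(2) by linarith
      then show ?thesis using cd(1) by blast
    qed
  qed
  then obtain c d where cd: "\<And>m. {c m..d m} \<subseteq> {l m<..<r m}"
    and le: "\<And>m x y. {x..y} \<subseteq> {l m<..<r m} \<Longrightarrow> \<bar>integral {x..y} f\<bar> \<le> 2 * \<bar>integral {c m..d m} f\<bar>"
    by metis
  define B where "B m = 2 * \<bar>integral {c m..d m} f\<bar>" for m
  have part: "(\<Sum>m<M. B m) \<le> 2 * k" for M
    using k cd by (auto simp: gap_variation_le_def B_def simp flip: sum_distrib_left)
  have sB: "summable B"
    by (rule bounded_imp_summable[where B = "2 * k"])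
      (use part[of "Suc _"] in \<open>auto simp: B_def lessThan_Suc_atMost\<close>)
  show thesis
  proof
    show "summable B" by (rule sB)
    show "suminf B \<le> 2 * k" by (rule suminf_le_const[OF sB part])
    show "\<bar>integral {x..y} f\<bar> \<le> B m" if "l m \<le> x" "y \<le> r m" for m x y
      using abs_integral_le_closed_interval[OF f _ that] le by (simp add: B_def)
  qed
qed

text \<open>Harnack's theorem splits \<open>f\<close> into its part over the gaps, whose integral is
  at most \<open>suminf B \<le> 2 * k\<close> in absolute value, and a remainder \<open>h\<close>
  whose absolute integral is at most \<open>k\<close>. Hence the factor 3.\<close>

lemma abs_integral_le_of_gap_variation:
  fixes f :: "real \<Rightarrow> real"
  assumes f: "\<And>a b. f integrable_on {a..b}"
    and disj: "disjoint_family (\<lambda>m. {l m<..<r m})" and U: "U = (\<Union>m. {l m<..<r m})"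
    and gv: "gap_variation_le f l r k"
    and nn: "(\<integral>\<^sup>+x. ennreal \<bar>if x \<in> {\<alpha>..\<beta>} - U then f x else 0\<bar> \<partial>lebesgue) \<le> ennreal k"
    and cd: "{c..d} \<subseteq> {\<alpha>..\<beta>}" and k0: "0 \<le> k"
  shows "\<bar>integral {c..d} f\<bar> \<le> 3 * k"
proof -
  obtain B where B: "summable B" "suminf B \<le> 2 * k"
    "\<And>m x y. l m \<le> x \<Longrightarrow> y \<le> r m \<Longrightarrow> \<bar>integral {x..y} f\<bar> \<le> B m"
    using gap_variation_le_summable_bound[OF f gv] by blast
  define J where "J m = integral {max (l m) c..min (r m) d} f" for m
  let ?u = "\<lambda>x. if x \<in> U then f x else 0"
  define h where "h x = f x - ?u x" for x
  have hU: "(?u has_integral suminf J) {c..d}"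
    using has_integral_disjoint_open_intervals[OF f disj B(3,1)] U by (simp add: J_def[abs_def])
  have JB: "\<bar>J m\<bar> \<le> B m" for m unfolding J_def by (rule B(3)) auto
  have "\<bar>suminf J\<bar> \<le> suminf B"
    using norm_suminf_le[of J B] JB B(1) by simp
  then have 1: "\<bar>integral {c..d} ?u\<bar> \<le> 2 * k" using B(2) integral_unique[OF hU] by simp
  have hI: "h integrable_on {c..d}"
    unfolding h_def using f hU by (intro integrable_diff) auto
  let ?h = "\<lambda>x. if x \<in> {c..d} then h x else 0"
  have "?h integrable_on UNIV" using hI by (simp only: integrable_restrict_UNIV)
  then have m: "?h \<in> borel_measurable lebesgue"
    using integrable_imp_measurable lebesgue_on_UNIV_eq by metis
  have "(\<integral>\<^sup>+x. ennreal \<bar>?h x\<bar> \<partial>lebesgue) \<le> (\<integral>\<^sup>+x. ennreal \<bar>if x \<in> {\<alpha>..\<beta>} - U then f x else 0\<bar> \<partial>lebesgue)"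
    using cd by (intro nn_integral_mono) (auto simp: h_def)
  with nn have le: "(\<integral>\<^sup>+x. ennreal \<bar>?h x\<bar> \<partial>lebesgue) \<le> ennreal k" by simp
  \<comment> \<open>Being finite, the Lebesgue integral of the absolute value is also a gauge
    integral, so it can be compared with the gauge integral of \<open>h\<close>.\<close>
  define R where "R = enn2real (\<integral>\<^sup>+x. ennreal \<bar>?h x\<bar> \<partial>lebesgue)"
  have fin: "(\<integral>\<^sup>+x. ennreal \<bar>?h x\<bar> \<partial>lebesgue) < top" using le ennreal_less_top le_less_trans by blast
  have R: "(\<integral>\<^sup>+x. ennreal \<bar>?h x\<bar> \<partial>lebesgue) = ennreal R" "0 \<le> R" "R \<le> k"
    using fin le k0 by (auto simp: R_def intro!: enn2real_leI)
  have "((\<lambda>x. \<bar>?h x\<bar>) has_integral R) UNIV"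
    using m R by (subst has_integral_iff_nn_integral_lebesgue) auto
  then have "((\<lambda>x. if x \<in> {c..d} then \<bar>h x\<bar> else 0) has_integral R) UNIV"
    by (rule has_integral_eq[rotated]) auto
  then have "((\<lambda>x. \<bar>h x\<bar>) has_integral R) {c..d}" by (simp only: has_integral_restrict_UNIV)
  then have "\<bar>integral {c..d} h\<bar> \<le> R"
    using Henstock_Kurzweil_Integration.integral_norm_bound_integral[OF hI, of "\<lambda>x. \<bar>h x\<bar>"] by (auto simp: has_integral_iff)
  moreover have "integral {c..d} h = integral {c..d} f - integral {c..d} ?u"
    unfolding h_def using f hU by (intro integral_diff) auto
  ultimately show ?thesis using 1 R(3) by linarith
qed

section \<open>A portion on which the primitive has bounded variation\<close>

definition endpoint_variation_le ::
    "(real \<Rightarrow> real) \<Rightarrow> real set \<Rightarrow> real \<Rightarrow> real \<Rightarrow> real \<Rightarrow> bool" where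
  "endpoint_variation_le f P a b K \<longleftrightarrow>
     (\<forall>S. finite S \<longrightarrow>
        (\<forall>(u, v)\<in>S. a \<le> u \<and> u < v \<and> v \<le> b \<and> (u \<in> P \<or> v \<in> P)) \<longrightarrow>
        (\<forall>s\<in>S. \<forall>t\<in>S. s \<noteq> t \<longrightarrow> snd s \<le> fst t \<or> snd t \<le> fst s) \<longrightarrow>
        (\<Sum>(u, v)\<in>S. \<bar>integral {u..v} f\<bar>) \<le> K)"

text \<open>Degenerate intervals contribute zero and are dropped; separation then makes the indexing
  injective, so the condition on sets of pairs applies to families.\<close>

lemma endpoint_variation_le_indexed:
  fixes u v :: "'i \<Rightarrow> real"
  assumes K: "endpoint_variation_le f P a b K" and fin: "finite I"
    and uv: "\<And>i. i \<in> I \<Longrightarrow> a \<le> u i \<and> u i \<le> v i \<and> v i \<le> b \<and> (u i \<in> P \<or> v i \<in> P)"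
    and sep: "\<And>i j. i \<in> I \<Longrightarrow> j \<in> I \<Longrightarrow> i \<noteq> j \<Longrightarrow> v i \<le> u j \<or> v j \<le> u i"
  shows "(\<Sum>i\<in>I. \<bar>integral {u i..v i} f\<bar>) \<le> K"
proof -
  define I' where "I' = {i \<in> I. u i < v i}"
  define S where "S = (\<lambda>i. (u i, v i)) ` I'"
  have inj: "inj_on (\<lambda>i. (u i, v i)) I'"
  proof (rule inj_onI)
    fix i j assume "i \<in> I'" "j \<in> I'" "(u i, v i) = (u j, v j)"
    then show "i = j" using sep[of i j] by (force simp: I'_def)
  qed
  have "(\<Sum>i\<in>I. \<bar>integral {u i..v i} f\<bar>) = (\<Sum>i\<in>I'. \<bar>integral {u i..v i} f\<bar>)"
  proof (rule sum.mono_neutral_right)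
    show "\<forall>i\<in>I - I'. \<bar>integral {u i..v i} f\<bar> = 0"
    proof
      fix i assume i: "i \<in> I - I'"
      then have "u i = v i" using uv[of i] by (auto simp: I'_def)
      then show "\<bar>integral {u i..v i} f\<bar> = 0" by simp
    qed
  qed (use fin in \<open>auto simp: I'_def\<close>)
  also have "\<dots> = (\<Sum>(u, v)\<in>S. \<bar>integral {u..v} f\<bar>)"
    unfolding S_def by (subst sum.reindex[OF inj]) simp
  also have "\<dots> \<le> K"
  proof (rule K[unfolded endpoint_variation_le_def, rule_format])
    show "finite S" using fin by (simp add: S_def I'_def)
    show "case x of (u, v) \<Rightarrow> a \<le> u \<and> u < v \<and> v \<le> b \<and> (u \<in> P \<or> v \<in> P)" if "x \<in> S" for x
      using that uv by (auto simp: S_def I'_def)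
    show "snd s \<le> fst t \<or> snd t \<le> fst s" if "s \<in> S" "t \<in> S" "s \<noteq> t" for s t
      using that sep by (auto simp: S_def I'_def) (metis that)+
  qed
  finally show ?thesis .
qed

text \<open>Tagged at an endpoint in \<open>E\<close>, each interval is fine because it is shorter
  than \<open>\<delta>\<close>. Henstock's lemma bounds the total deviation of the integrals from
  value times length by 1, and the values times lengths add up to at most
  \<open>N * (b - a)\<close>.\<close>

lemma Henstock_endpoint_variation:
  fixes f :: "real \<Rightarrow> real" and u v :: "'i \<Rightarrow> real"
  assumes hen: "\<And>p. p tagged_partial_division_of cbox A B \<Longrightarrow> \<gamma> fine p \<Longrightarrow>
        (\<Sum>(x, K)\<in>p. norm (measure lborel K *\<^sub>R f x - integral K f)) < 1"
    and E: "\<And>t. t \<in> E \<Longrightarrow> ball t \<delta> \<subseteq> \<gamma> t \<and> \<bar>f t\<bar> \<le> N"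
    and ab: "A \<le> a" "b \<le> B" "b - a < \<delta>" "a \<le> b" and fin: "finite I" and N: "0 \<le> N"
    and uv: "\<And>i. i \<in> I \<Longrightarrow> a \<le> u i \<and> u i < v i \<and> v i \<le> b \<and> (u i \<in> E \<or> v i \<in> E)"
    and sep: "\<And>i j. i \<in> I \<Longrightarrow> j \<in> I \<Longrightarrow> i \<noteq> j \<Longrightarrow> v i \<le> u j \<or> v j \<le> u i"
  shows "(\<Sum>i\<in>I. \<bar>integral {u i..v i} f\<bar>) \<le> 1 + N * (b - a)"
proof -
  define t where "t i = (if u i \<in> E then u i else v i)" for i
  have t: "t i \<in> E" "t i \<in> {u i..v i}" if "i \<in> I" for i
    using uv[OF that] by (auto simp: t_def)
  have int: "interior {u i..v i} \<inter> interior {u j..v j} = {}" if "i \<in> I" "j \<in> I" "i \<noteq> j" for i j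
    using sep[OF that] by (auto simp: interior_atLeastAtMost_real)
  have inj: "inj_on (\<lambda>i. {u i..v i}) I"
  proof (rule inj_onI, rule ccontr)
    fix i j assume ij: "i \<in> I" "j \<in> I" "{u i..v i} = {u j..v j}" "i \<noteq> j"
    then have "interior {u i..v i} = {}" using int[OF ij(1,2,4)] ij(3) by (metis Int_absorb)
    then show False using uv[of i] ij by (simp add: interior_atLeastAtMost_real)
  qed
  have inj2: "inj_on (\<lambda>i. (t i, {u i..v i})) I"
    using inj by (auto simp: inj_on_def)
  define p where "p = (\<lambda>i. (t i, {u i..v i})) ` I"
  have "p tagged_partial_division_of cbox A B"
    unfolding tagged_partial_division_of_def
  proof (intro conjI allI impI)
    show "finite p" using fin by (simp add: p_def)
    show "x \<in> K" if "(x, K) \<in> p" for x K using that t by (auto simp: p_def)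
    show "K \<subseteq> cbox A B" if xK: "(x, K) \<in> p" for x K
    proof -
      obtain i where "i \<in> I" "K = {u i..v i}" using xK by (auto simp: p_def)
      then show ?thesis using uv[of i] ab by auto
    qed
    show "\<exists>a b. K = cbox a b" if "(x, K) \<in> p" for x K
      using that by (auto simp: p_def box_real(2)[symmetric] simp del: box_real(2))
    show "interior K1 \<inter> interior K2 = {}"
      if h: "(x1, K1) \<in> p \<and> (x2, K2) \<in> p \<and> (x1, K1) \<noteq> (x2, K2)" for x1 K1 x2 K2
    proof -
      obtain i j where "i \<in> I" "j \<in> I" "K1 = {u i..v i}" "K2 = {u j..v j}" "i \<noteq> j"
        using h by (auto simp: p_def)
      then show ?thesis using int by blast
    qed
  qed
  moreover have "\<gamma> fine p"
  proof (rule fineI)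
    fix x K assume "(x, K) \<in> p"
    then obtain i where i: "i \<in> I" "x = t i" "K = {u i..v i}" by (auto simp: p_def)
    have "K \<subseteq> ball x \<delta>"
      using uv[OF i(1)] t[OF i(1)] ab i by (auto simp: dist_real_def)
    then show "K \<subseteq> \<gamma> x" using E[of x] t[OF i(1)] i by blast
  qed
  ultimately have "(\<Sum>(x, K)\<in>p. norm (measure lborel K *\<^sub>R f x - integral K f)) < 1"
    by (rule hen)
  then have 1: "(\<Sum>i\<in>I. \<bar>measure lborel {u i..v i} * f (t i) - integral {u i..v i} f\<bar>) < 1"
    unfolding p_def by (subst (asm) sum.reindex[OF inj2]) simp
  have "(\<lambda>i. {u i..v i}) ` I division_of (\<Union>i\<in>I. {u i..v i})"
    unfolding division_of_def
  proof (intro conjI ballI impI)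
    show "\<exists>a b. K = cbox a b" if "K \<in> (\<lambda>i. {u i..v i}) ` I" for K
      using that by (auto simp: box_real(2)[symmetric] simp del: box_real(2))
    show "K \<noteq> {}" if "K \<in> (\<lambda>i. {u i..v i}) ` I" for K using that uv by force
    show "interior K1 \<inter> interior K2 = {}"
      if "K1 \<in> (\<lambda>i. {u i..v i}) ` I" "K2 \<in> (\<lambda>i. {u i..v i}) ` I" "K1 \<noteq> K2" for K1 K2
      using that int by blast
  qed (use fin in auto)
  moreover have "(\<Union>i\<in>I. {u i..v i}) \<subseteq> cbox a b" using uv by fastforce
  ultimately have "sum (measure lborel) ((\<lambda>i. {u i..v i}) ` I) \<le> measure lborel (cbox a b)"
    by (rule subadditive_content_division)
  then have 2: "(\<Sum>i\<in>I. measure lborel {u i..v i}) \<le> b - a"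
    using ab(4) by (subst (asm) sum.reindex[OF inj]) simp
  have "\<bar>integral {u i..v i} f\<bar> \<le>
      \<bar>measure lborel {u i..v i} * f (t i) - integral {u i..v i} f\<bar> + N * measure lborel {u i..v i}"
    if "i \<in> I" for i
  proof -
    have "\<bar>measure lborel {u i..v i} * f (t i)\<bar> \<le> measure lborel {u i..v i} * N"
      using E[OF t(1)[OF that]] by (simp add: abs_mult mult_left_mono)
    then show ?thesis by (simp add: mult.commute)
  qed
  then have "(\<Sum>i\<in>I. \<bar>integral {u i..v i} f\<bar>) \<le>
      (\<Sum>i\<in>I. \<bar>measure lborel {u i..v i} * f (t i) - integral {u i..v i} f\<bar> + N * measure lborel {u i..v i})"
    by (rule sum_mono)
  also have "\<dots> = (\<Sum>i\<in>I. \<bar>measure lborel {u i..v i} * f (t i) - integral {u i..v i} f\<bar>)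
      + N * (\<Sum>i\<in>I. measure lborel {u i..v i})"
    by (simp only: sum.distrib sum_distrib_left)
  also have "\<dots> \<le> 1 + N * (b - a)"
    using 1 2 N by (intro add_mono mult_left_mono) auto
  finally show ?thesis .
qed

section \<open>Category argument on a closed set\<close>

text \<open>If no \<open>closure (E n)\<close> contained a portion of \<open>S\<close>, every
  \<open>S - closure (E n)\<close> would be relatively open and dense in \<open>S\<close>, so their
  intersection would be dense; but it is empty.\<close>

lemma Baire_closed_countable_Union:
  fixes S :: "'a::{real_normed_vector,heine_borel} set" and E :: "nat \<Rightarrow> 'a set"
  assumes "closed S" "S \<noteq> {}" "S \<subseteq> (\<Union>n. E n)"
  obtains n x e where "x \<in> S" "e > 0" "ball x e \<inter> S \<subseteq> closure (E n)"
proof (rule ccontr)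
  assume neg: "\<not> thesis"
  have "S \<subseteq> closure (\<Inter>(range (\<lambda>n. S - closure (E n))))"
  proof (rule Baire[OF assms(1)])
    fix T assume "T \<in> range (\<lambda>n. S - closure (E n))"
    then obtain n where T: "T = S - closure (E n)" by blast
    have "openin (top_of_set S) (S \<inter> (- closure (E n)))"
      by (rule openin_open_Int) (simp add: open_Compl)
    moreover have "S \<subseteq> closure T"
    proof
      fix x assume x: "x \<in> S"
      show "x \<in> closure T"
      proof (rule ccontr)
        assume "x \<notin> closure T"
        then obtain e where e: "e > 0" "ball x e \<inter> closure T = {}"
          using open_contains_ball[of "- closure T"] by (auto simp: disjoint_iff subset_iff)
        then have "ball x e \<inter> S \<subseteq> closure (E n)" using T closure_subset[of T] by blast
        then show False using neg that x e(1) by blast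
      qed
    qed
    ultimately show "openin (top_of_set S) T \<and> S \<subseteq> closure T"
      by (simp add: T Diff_eq)
  qed simp
  moreover have "\<Inter>(range (\<lambda>n. S - closure (E n))) = {}"
    using assms(3) closure_subset by blast
  ultimately show False using assms(2) by (metis closure_empty subset_empty)
qed

text \<open>On some portion of \<open>P\<close> one of the sets \<open>E n\<close>, with uniform
  gauge and bounded values, is dense. The estimate for endpoints in \<open>E n\<close> passes to
  endpoints in \<open>P\<close> by continuity of the primitive. Rational ends leave only countably
  many candidate portions.\<close>

lemma exists_portion_endpoint_variation_le:
  fixes f :: "real \<Rightarrow> real"
  assumes f: "\<And>a b. f integrable_on {a..b}"
    and P: "closed P" "P \<noteq> {}" "P \<subseteq> {a..b}"
  obtains \<alpha> \<beta> K where "\<alpha> \<in> \<rat>" "\<beta> \<in> \<rat>" "P \<inter> {\<alpha><..<\<beta>} \<noteq> {}" "endpoint_variation_le f P \<alpha> \<beta> K"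
proof -
  \<comment> \<open>The margin 1 leaves room for a neighbourhood of a point of \<open>P\<close> that
    lies at an end of \<open>{a..b}\<close>.\<close>
  have "f integrable_on cbox (a - 1) (b + 1)" using f by simp
  then obtain \<gamma> where \<gamma>: "gauge \<gamma>"
    and hen: "\<And>p. p tagged_partial_division_of cbox (a - 1) (b + 1) \<Longrightarrow> \<gamma> fine p \<Longrightarrow>
        (\<Sum>(x, K)\<in>p. norm (measure lborel K *\<^sub>R f x - integral K f)) < 1"
    by (rule Henstock_lemma[OF _ zero_less_one]) blast
  define E where "E n = {t \<in> P. ball t (inverse (real (Suc n))) \<subseteq> \<gamma> t \<and> \<bar>f t\<bar> \<le> real n}" for n
  have "P \<subseteq> (\<Union>n. E n)"
  proof
    fix t assume t: "t \<in> P"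
    obtain e where e: "e > 0" "ball t e \<subseteq> \<gamma> t"
      using \<gamma> unfolding gauge_def by (meson open_contains_ball)
    obtain n1 where n1: "inverse (real (Suc n1)) < e" using reals_Archimedean[OF e(1)] by blast
    obtain n2 where n2: "\<bar>f t\<bar> \<le> real n2" using real_arch_simple by blast
    let ?n = "max n1 n2"
    have "inverse (real (Suc ?n)) \<le> inverse (real (Suc n1))" by (intro le_imp_inverse_le) auto
    then have "ball t (inverse (real (Suc ?n))) \<subseteq> \<gamma> t" 
      using n1 e(2) subset_ball[of "inverse (real (Suc ?n))" e t] by (meson le_less_trans less_imp_le subset_trans)
    then have "t \<in> E ?n" using t n2 by (simp add: E_def)
    then show "t \<in> (\<Union>n. E n)" by blast
  qed
  then obtain n x e where x: "x \<in> P" and e: "e > 0" and cl: "ball x e \<inter> P \<subseteq> closure (E n)"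
    by (rule Baire_closed_countable_Union[OF P(1,2)])
  define \<delta> where "\<delta> = inverse (real (Suc n))"
  have \<delta>: "\<delta> > 0" "\<delta> \<le> 1" by (auto simp: \<delta>_def inverse_eq_divide)
  \<comment> \<open>With \<open>\<delta> / 3\<close> the interval
    \<open>{x - \<eta>..x + \<eta>}\<close> is shorter than \<open>\<delta>\<close>, so all its
    subintervals are fine when tagged in \<open>E n\<close>.\<close>
  define \<eta> where "\<eta> = min e (\<delta> / 3)"
  have \<eta>: "\<eta> > 0" "\<eta> \<le> e" "\<eta> \<le> \<delta> / 3" using e \<delta> by (auto simp: \<eta>_def)
  obtain \<alpha> where \<alpha>: "\<alpha> \<in> \<rat>" "x - \<eta> < \<alpha>" "\<alpha> < x" using Rats_dense_in_real[of "x - \<eta>" x] \<eta> by auto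
  obtain \<beta> where \<beta>: "\<beta> \<in> \<rat>" "x < \<beta>" "\<beta> < x + \<eta>" using Rats_dense_in_real[of x "x + \<eta>"] \<eta> by auto
  \<comment> \<open>The larger interval is used because endpoints moved into \<open>E n\<close> may
    leave \<open>{\<alpha>..\<beta>}\<close>; eventually they stay within \<open>\<eta>\<close> of
    \<open>x\<close>.\<close>
  define K where "K = 1 + real n * ((x + \<eta>) - (x - \<eta>))"
  have "endpoint_variation_le f P \<alpha> \<beta> K"
    unfolding endpoint_variation_le_def
  proof (intro allI impI)
    fix S :: "(real \<times> real) set"
    assume fin: "finite S"
      and S: "\<forall>(u, v)\<in>S. \<alpha> \<le> u \<and> u < v \<and> v \<le> \<beta> \<and> (u \<in> P \<or> v \<in> P)"
      and sep: "\<forall>s\<in>S. \<forall>t\<in>S. s \<noteq> t \<longrightarrow> snd s \<le> fst t \<or> snd t \<le> fst s"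
    \<comment> \<open>Endpoints in \<open>P\<close> are approximated by points of \<open>E n\<close>; since equal endpoints are moved to
      equal points, the intervals eventually remain non-overlapping.\<close>
    have ex: "\<exists>y. \<bar>y - z\<bar> < inverse (real (Suc j)) \<and> (z \<in> P \<inter> {\<alpha>..\<beta>} \<longrightarrow> y \<in> E n)" for z j
    proof (cases "z \<in> P \<inter> {\<alpha>..\<beta>}")
      case True
      then have "z \<in> closure (E n)"
        using cl \<alpha> \<beta> \<eta> by (auto simp: dist_real_def subset_iff abs_less_iff)
      then obtain y where "y \<in> E n" "dist y z < inverse (real (Suc j))"
        unfolding closure_approachable by (metis inverse_positive_iff_positive of_nat_0_less_iff zero_less_Suc)
      then show ?thesis by (auto simp: dist_real_def)
    qed (auto intro!: exI[of _ z])
    define \<phi> where "\<phi> j z = (SOME y. \<bar>y - z\<bar> < inverse (real (Suc j)) \<and> (z \<in> P \<inter> {\<alpha>..\<beta>} \<longrightarrow> y \<in> E n))" for j z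
    have \<phi>: "\<bar>\<phi> j z - z\<bar> < inverse (real (Suc j))" and \<phi>E: "z \<in> P \<inter> {\<alpha>..\<beta>} \<Longrightarrow> \<phi> j z \<in> E n" for j z
      using someI_ex[OF ex[of z j], folded \<phi>_def] by blast+
    have lim: "(\<lambda>j. \<phi> j z) \<longlonglongrightarrow> z" for z
    proof (rule LIM_zero_cancel, rule Lim_null_comparison[OF _ LIMSEQ_inverse_real_of_nat])
      show "\<forall>\<^sub>F j in sequentially. norm (\<phi> j z - z) \<le> inverse (real (Suc j))"
        using \<phi> by (intro always_eventually allI) (simp add: less_imp_le)
    qed
    have lt: "\<forall>\<^sub>F j in sequentially. \<phi> j z < \<phi> j w" if "z < w" for z w
      using order_tendstoD(2)[OF lim, of z "(z + w) / 2"] order_tendstoD(1)[OF lim, of "(z + w) / 2" w] that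
      by (force elim: eventually_elim2)
    have le: "\<forall>\<^sub>F j in sequentially. \<phi> j z \<le> \<phi> j w" if "z \<le> w" for z w
      using lt[of z w] that by (cases "z = w") (auto elim: eventually_mono)
    have ev1: "\<forall>\<^sub>F j in sequentially. \<forall>s\<in>S. x - \<eta> \<le> \<phi> j (fst s) \<and> \<phi> j (fst s) < \<phi> j (snd s) \<and> \<phi> j (snd s) \<le> x + \<eta>"
    proof (intro eventually_ball_finite[OF fin] ballI eventually_conj)
      fix s assume "s \<in> S"
      then have s: "\<alpha> \<le> fst s" "fst s < snd s" "snd s \<le> \<beta>" using S by auto
      show "\<forall>\<^sub>F j in sequentially. \<phi> j (fst s) < \<phi> j (snd s)" by (rule lt[OF s(2)])
      have "x - \<eta> < fst s" "snd s < x + \<eta>" using s \<alpha> \<beta> by auto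
      from order_tendstoD(1)[OF lim this(1)] order_tendstoD(2)[OF lim this(2)]
      show "\<forall>\<^sub>F j in sequentially. x - \<eta> \<le> \<phi> j (fst s)" "\<forall>\<^sub>F j in sequentially. \<phi> j (snd s) \<le> x + \<eta>"
        by (auto elim: eventually_mono)
    qed
    have ev2: "\<forall>\<^sub>F j in sequentially. \<forall>s\<in>S. \<forall>t\<in>S. s \<noteq> t \<longrightarrow>
        \<phi> j (snd s) \<le> \<phi> j (fst t) \<or> \<phi> j (snd t) \<le> \<phi> j (fst s)"
    proof (intro eventually_ball_finite[OF fin] ballI)
      fix s t assume st: "s \<in> S" "t \<in> S"
      show "\<forall>\<^sub>F j in sequentially. s \<noteq> t \<longrightarrow> \<phi> j (snd s) \<le> \<phi> j (fst t) \<or> \<phi> j (snd t) \<le> \<phi> j (fst s)"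
      proof (cases "s = t")
        case False
        then have "snd s \<le> fst t \<or> snd t \<le> fst s" using sep st by blast
        then show ?thesis
        proof
          assume "snd s \<le> fst t"
          from le[OF this] show ?thesis by (auto elim: eventually_mono)
        next
          assume "snd t \<le> fst s"
          from le[OF this] show ?thesis by (auto elim: eventually_mono)
        qed
      qed simp
    qed
    have bound: "\<forall>\<^sub>F j in sequentially. (\<Sum>s\<in>S. \<bar>integral {\<phi> j (fst s)..\<phi> j (snd s)} f\<bar>) \<le> K"
      using ev1 ev2
    proof eventually_elim
      case (elim j)
      show ?case
        unfolding K_def
      proof (rule Henstock_endpoint_variation[OF hen, where \<delta> = \<delta> and E = "E n"])
        show "ball t \<delta> \<subseteq> \<gamma> t \<and> \<bar>f t\<bar> \<le> real n" if "t \<in> E n" for t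
          using that by (simp add: E_def \<delta>_def)
        show "a - 1 \<le> x - \<eta>" "x + \<eta> \<le> b + 1" "x - \<eta> \<le> x + \<eta>" "x + \<eta> - (x - \<eta>) < \<delta>"
          using x P(3) \<eta> \<delta> by auto
        fix s assume s: "s \<in> S"
        then have "fst s \<in> P \<inter> {\<alpha>..\<beta>} \<or> snd s \<in> P \<inter> {\<alpha>..\<beta>}" using S by fastforce
        then show "x - \<eta> \<le> \<phi> j (fst s) \<and> \<phi> j (fst s) < \<phi> j (snd s) \<and> \<phi> j (snd s) \<le> x + \<eta> \<and>
            (\<phi> j (fst s) \<in> E n \<or> \<phi> j (snd s) \<in> E n)"
          using elim(1) s \<phi>E by blast
        fix t assume "t \<in> S" "s \<noteq> t"
        then show "\<phi> j (snd s) \<le> \<phi> j (fst t) \<or> \<phi> j (snd t) \<le> \<phi> j (fst s)"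
          using elim(2) s by blast
      qed (use fin in auto)
    qed
    \<comment> \<open>The bound holds for the moved intervals. Writing the integrals as differences
      of a continuous primitive permits the limit in \<open>j\<close>.\<close>
    define F where "F z = integral {x - \<eta>..z} f" for z
    have cont: "continuous_on {x - \<eta>..x + \<eta>} F"
      unfolding F_def by (rule indefinite_integral_continuous_1) (rule f)
    have Feq: "integral {z..w} f = F w - F z" if "x - \<eta> \<le> z" "z \<le> w" for z w
      using Henstock_Kurzweil_Integration.integral_combine[OF that f] by (simp add: F_def)
    have "(\<lambda>j. \<Sum>s\<in>S. \<bar>F (\<phi> j (snd s)) - F (\<phi> j (fst s))\<bar>) \<longlonglongrightarrow> (\<Sum>s\<in>S. \<bar>F (snd s) - F (fst s)\<bar>)"
    proof (intro tendsto_sum tendsto_rabs tendsto_diff)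
      fix s assume s: "s \<in> S"
      then have in1: "fst s \<in> {x - \<eta>..x + \<eta>}" "snd s \<in> {x - \<eta>..x + \<eta>}" using S \<alpha> \<beta> by fastforce+
      have in2: "\<forall>\<^sub>F j in sequentially. \<phi> j (fst s) \<in> {x - \<eta>..x + \<eta>}"
        "\<forall>\<^sub>F j in sequentially. \<phi> j (snd s) \<in> {x - \<eta>..x + \<eta>}"
        by (rule eventually_mono[OF ev1]; use s in fastforce)+
      show "(\<lambda>j. F (\<phi> j (snd s))) \<longlonglongrightarrow> F (snd s)" "(\<lambda>j. F (\<phi> j (fst s))) \<longlonglongrightarrow> F (fst s)"
        by (rule continuous_on_tendsto_compose[OF cont lim]; use in1 in2 in blast)+
    qed
    moreover have "\<forall>\<^sub>F j in sequentially. (\<Sum>s\<in>S. \<bar>F (\<phi> j (snd s)) - F (\<phi> j (fst s))\<bar>) \<le> K"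
      using bound ev1
    proof eventually_elim
      case (elim j)
      have "(\<Sum>s\<in>S. \<bar>F (\<phi> j (snd s)) - F (\<phi> j (fst s))\<bar>) = (\<Sum>s\<in>S. \<bar>integral {\<phi> j (fst s)..\<phi> j (snd s)} f\<bar>)"
        using elim(2) by (intro sum.cong refl arg_cong[of _ _ abs] Feq[symmetric]) (auto intro: less_imp_le)
      then show ?case using elim(1) by simp
    qed
    ultimately have "(\<Sum>s\<in>S. \<bar>F (snd s) - F (fst s)\<bar>) \<le> K"
      by (rule tendsto_upperbound) simp
    moreover have "(\<Sum>(u, v)\<in>S. \<bar>integral {u..v} f\<bar>) = (\<Sum>s\<in>S. \<bar>F (snd s) - F (fst s)\<bar>)"
    proof (rule sum.cong[OF refl])
      fix s assume "s \<in> S"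
      then have "x - \<eta> \<le> fst s" "fst s \<le> snd s" using S \<alpha> by fastforce+
      then show "(case s of (u, v) \<Rightarrow> \<bar>integral {u..v} f\<bar>) = \<bar>F (snd s) - F (fst s)\<bar>"
        by (simp add: Feq case_prod_beta)
    qed
    ultimately show "(\<Sum>(u, v)\<in>S. \<bar>integral {u..v} f\<bar>) \<le> K" by simp
  qed
  moreover have "P \<inter> {\<alpha><..<\<beta>} \<noteq> {}" using x \<alpha> \<beta> by auto
  ultimately show thesis using that \<alpha> \<beta> by blast
qed

section \<open>Summable oscillations over the gaps and Lebesgue integrability on the portion\<close>

text \<open>Every gap has an endpoint in \<open>P\<close>. An integral inside the gap is the
  difference of two integrals over intervals that share this endpoint, whence the factor 2.\<close>

lemma gap_variation_le_of_endpoint_variation: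
  fixes f :: "real \<Rightarrow> real"
  assumes f: "\<And>a b. f integrable_on {a..b}"
    and P: "P \<inter> {\<alpha><..<\<beta>} \<noteq> {}" and K: "endpoint_variation_le f P \<alpha> \<beta> K"
    and disj: "disjoint_family (\<lambda>m. {l m<..<r m})"
    and U: "{\<alpha><..<\<beta>} - P = (\<Union>m. {l m<..<r m})"
    and ends: "\<And>m. l m < r m \<Longrightarrow> l m \<notin> {\<alpha><..<\<beta>} - P \<and> r m \<notin> {\<alpha><..<\<beta>} - P"
  shows "gap_variation_le f l r (2 * K)"
  unfolding gap_variation_le_def
proof (intro allI impI)
  fix M :: nat and c d :: "nat \<Rightarrow> real"
  assume cd: "\<forall>m<M. {c m..d m} \<subseteq> {l m<..<r m}"
  define I where "I = {m. m < M \<and> c m \<le> d m}"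
  have fin: "finite I" by (simp add: I_def)
  have I: "l m < c m" "c m \<le> d m" "d m < r m" if "m \<in> I" for m
    using cd that by (auto simp: I_def subset_iff)
  have lr: "\<alpha> \<le> l m" "r m \<le> \<beta>" "l m < r m" "l m \<in> P \<or> r m \<in> P" if m: "m \<in> I" for m
  proof -
    show less: "l m < r m" using I[OF m] by linarith
    have sub: "{l m<..<r m} \<subseteq> {\<alpha><..<\<beta>} - P" using U by blast
    then have "{l m<..<r m} \<subseteq> {\<alpha><..<\<beta>}" by blast
    then show 1: "\<alpha> \<le> l m" "r m \<le> \<beta>"
      using less by (auto simp: greaterThanLessThan_subseteq_greaterThanLessThan)
    show "l m \<in> P \<or> r m \<in> P"
    proof (rule ccontr)
      assume no: "\<not> ?thesis"
      \<comment> \<open>An endpoint in neither \<open>P\<close> nor the open set can only be an end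
        of \<open>{\<alpha><..<\<beta>}\<close>, so the gap would fill this interval, which meets
        \<open>P\<close>.\<close>
      then have "l m = \<alpha>" "r m = \<beta>" using ends[OF less] 1 less by auto
      then show False using P sub by blast
    qed
  qed
  have sep: "r m \<le> l n \<or> r n \<le> l m" if "m \<in> I" "n \<in> I" "m \<noteq> n" for m n
  proof -
    have "{l m<..<r m} \<inter> {l n<..<r n} = {}" using disj that by (auto simp: disjoint_family_on_def)
    then show ?thesis using lr(3)[OF that(1)] lr(3)[OF that(2)] by (auto simp: max_def min_def split: if_splits)
  qed
  \<comment> \<open>The first family runs between the endpoint in \<open>P\<close> and the far end
    of \<open>{c m..d m}\<close>, the second between that endpoint and the near end.\<close>
  define u1 where "u1 m = (if l m \<in> P then l m else c m)" for m
  define v1 where "v1 m = (if l m \<in> P then d m else r m)" for m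
  define u2 where "u2 m = (if l m \<in> P then l m else d m)" for m
  define v2 where "v2 m = (if l m \<in> P then c m else r m)" for m
  have b1: "(\<Sum>m\<in>I. \<bar>integral {u1 m..v1 m} f\<bar>) \<le> K"
  proof (rule endpoint_variation_le_indexed[OF K fin])
    show "\<alpha> \<le> u1 m \<and> u1 m \<le> v1 m \<and> v1 m \<le> \<beta> \<and> (u1 m \<in> P \<or> v1 m \<in> P)" if "m \<in> I" for m
      using I[OF that] lr[OF that] by (auto simp: u1_def v1_def)
    show "v1 m \<le> u1 n \<or> v1 n \<le> u1 m" if "m \<in> I" "n \<in> I" "m \<noteq> n" for m n
      using sep[OF that] I[OF that(1)] I[OF that(2)] by (auto simp: u1_def v1_def)
  qed
  have b2: "(\<Sum>m\<in>I. \<bar>integral {u2 m..v2 m} f\<bar>) \<le> K"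
  proof (rule endpoint_variation_le_indexed[OF K fin])
    show "\<alpha> \<le> u2 m \<and> u2 m \<le> v2 m \<and> v2 m \<le> \<beta> \<and> (u2 m \<in> P \<or> v2 m \<in> P)" if "m \<in> I" for m
      using I[OF that] lr[OF that] by (auto simp: u2_def v2_def)
    show "v2 m \<le> u2 n \<or> v2 n \<le> u2 m" if "m \<in> I" "n \<in> I" "m \<noteq> n" for m n
      using sep[OF that] I[OF that(1)] I[OF that(2)] by (auto simp: u2_def v2_def)
  qed
  have "(\<Sum>m<M. \<bar>integral {c m..d m} f\<bar>) = (\<Sum>m\<in>I. \<bar>integral {c m..d m} f\<bar>)"
    by (rule sum.mono_neutral_right) (auto simp: I_def)
  also have "\<dots> \<le> (\<Sum>m\<in>I. \<bar>integral {u1 m..v1 m} f\<bar> + \<bar>integral {u2 m..v2 m} f\<bar>)"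
  proof (rule sum_mono)
    fix m assume m: "m \<in> I"
    show "\<bar>integral {c m..d m} f\<bar> \<le> \<bar>integral {u1 m..v1 m} f\<bar> + \<bar>integral {u2 m..v2 m} f\<bar>"
    proof (cases "l m \<in> P")
      case True
      have "integral {l m..c m} f + integral {c m..d m} f = integral {l m..d m} f"
        using I[OF m] f by (intro Henstock_Kurzweil_Integration.integral_combine) auto
      then show ?thesis using True by (simp add: u1_def v1_def u2_def v2_def)
    next
      case False
      have "integral {c m..d m} f + integral {d m..r m} f = integral {c m..r m} f"
        using I[OF m] f by (intro Henstock_Kurzweil_Integration.integral_combine) auto
      then show ?thesis using False by (simp add: u1_def v1_def u2_def v2_def)
    qed
  qed
  also have "\<dots> \<le> 2 * K" using b1 b2 by (simp add: sum.distrib)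
  finally show "(\<Sum>m<M. \<bar>integral {c m..d m} f\<bar>) \<le> 2 * K" .
qed

text \<open>An interval with both ends outside the gap either covers it or meets it in nothing, and
  at most one of several non-overlapping intervals can cover it.\<close>

lemma sum_integral_gaps_between_endpoints_le:
  fixes f :: "real \<Rightarrow> real" and u v :: "'i \<Rightarrow> real"
  assumes disj: "\<And>i j. i \<in> I \<Longrightarrow> j \<in> I \<Longrightarrow> i \<noteq> j \<Longrightarrow> v i \<le> u j \<or> v j \<le> u i"
    and out: "\<And>i. i \<in> I \<Longrightarrow> u i \<notin> {l<..<r} \<and> v i \<notin> {l<..<r}"
    and B: "\<And>x y. l \<le> x \<Longrightarrow> y \<le> r \<Longrightarrow> \<bar>integral {x..y} f\<bar> \<le> B"
  shows "(\<Sum>i\<in>I. \<bar>integral {max l (u i)..min r (v i)} f\<bar>) \<le> B"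
proof (rule sum_at_most_one_nonzero_le)
  have covers: "u i \<le> l \<and> l < r \<and> r \<le> v i"
    if "i \<in> I" "\<bar>integral {max l (u i)..min r (v i)} f\<bar> \<noteq> 0" for i
  proof -
    have "max l (u i) < min r (v i)"
    proof (rule ccontr)
      assume "\<not> ?thesis"
      then have "integral {max l (u i)..min r (v i)} f = 0"
        by (cases "max l (u i) = min r (v i)") auto
      with that(2) show False by simp
    qed
    then show ?thesis using out[OF that(1)] by auto
  qed
  fix i j assume ij: "i \<in> I" "j \<in> I"
    "\<bar>integral {max l (u i)..min r (v i)} f\<bar> \<noteq> 0" "\<bar>integral {max l (u j)..min r (v j)} f\<bar> \<noteq> 0"
  show "i = j"
  proof (rule ccontr)
    assume "i \<noteq> j"
    then show False using covers[OF ij(1,3)] covers[OF ij(2,4)] disj[OF ij(1,2)] by linarith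
  qed
next
  \<comment> \<open>The left end exceeds the right one, so the integral is over the empty
    set.\<close>
  show "0 \<le> B" using B[of "max l r + 1" "min l r"] by simp
qed (use B in auto)

text \<open>Removing the gap part of \<open>f\<close> leaves \<open>h\<close>. Each member of a
  division is shrunk to the hull of its points in \<open>P\<close>: the integrals of
  \<open>f\<close> over the hulls cost \<open>K\<close>, the gaps inside them
  \<open>suminf B\<close>. So the primitive of \<open>h\<close> has bounded variation, which makes
  \<open>h\<close> absolutely integrable.\<close>

lemma nn_integral_portion_finite:
  fixes f :: "real \<Rightarrow> real"
  assumes f: "\<And>a b. f integrable_on {a..b}" and cP: "closed P"
    and K: "endpoint_variation_le f P \<alpha> \<beta> K"
    and disj: "disjoint_family (\<lambda>m. {l m<..<r m})"
    and U: "{\<alpha><..<\<beta>} - P = (\<Union>m. {l m<..<r m})"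
    and gv: "gap_variation_le f l r k"
  shows "(\<integral>\<^sup>+x. ennreal \<bar>if x \<in> {\<alpha>..\<beta>} - ({\<alpha><..<\<beta>} - P) then f x else 0\<bar> \<partial>lebesgue) < \<infinity>"
proof -
  obtain B where B: "summable B" and "suminf B \<le> 2 * k" and B':
    "\<And>m x y. l m \<le> x \<Longrightarrow> y \<le> r m \<Longrightarrow> \<bar>integral {x..y} f\<bar> \<le> B m"
    by (rule gap_variation_le_summable_bound[OF f gv]) (rule that)
  define V where "V = {\<alpha><..<\<beta>} - P"
  let ?u = "\<lambda>x. if x \<in> V then f x else 0"
  define h where "h x = (if x \<in> {\<alpha>..\<beta>} - V then f x else 0)" for x
  define J where "J p q m = integral {max (l m) p..min (r m) q} f" for p q m
  have JB: "\<bar>J p q m\<bar> \<le> B m" for p q m unfolding J_def by (rule B') auto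
  have sJ: "summable (\<lambda>m. \<bar>J p q m\<bar>)" for p q
    by (rule summable_comparison_test[OF _ B]) (use JB in auto)
  have uint: "(?u has_integral suminf (J p q)) {p..q}" for p q
    using has_integral_disjoint_open_intervals[OF f disj B' B] U by (simp add: J_def[abs_def] V_def)
  have hint: "(h has_integral (integral {p..q} f - suminf (J p q))) {p..q}" if "{p..q} \<subseteq> {\<alpha>..\<beta>}" for p q
  proof -
    have "((\<lambda>x. f x - ?u x) has_integral (integral {p..q} f - suminf (J p q))) {p..q}"
      using f uint by (intro has_integral_diff) auto
    then show ?thesis
      by (rule has_integral_eq[rotated]) (use that in \<open>auto simp: h_def\<close>)
  qed
  \<comment> \<open>At the ends \<open>h\<close> may be nonzero, as they may belong to
    \<open>P\<close> or be \<open>\<alpha>\<close> or \<open>\<beta>\<close>; two points do not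
    affect the integral.\<close>
  have h0: "(h has_integral 0) {p..q}"
    if no: "\<And>x. p < x \<Longrightarrow> x < q \<Longrightarrow> x \<notin> P" and pq: "\<alpha> \<le> p" "q \<le> \<beta>" for p q
  proof (rule has_integral_spike_finite[where S = "{p, q}" and f = "\<lambda>_. 0"])
    fix x assume "x \<in> {p..q} - {p, q}"
    then have "p < x" "x < q" by auto
    then show "h x = 0" using no[of x] pq by (simp add: h_def V_def)
  qed auto
  have bv: "(\<Sum>C\<in>d. norm (integral C h)) \<le> K + suminf B" if d: "d division_of cbox \<alpha> \<beta>" for d
  proof -
    note dD = division_ofD[OF d]
    define d' where "d' = {C \<in> d. C \<inter> P \<noteq> {} \<and> interior C \<noteq> {}}"
    have fin: "finite d" "finite d'" using dD(1) by (auto simp: d'_def)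
    \<comment> \<open>The ends of the hull of \<open>C \<inter> P\<close>; the rest of
      \<open>C\<close> contributes nothing to the integral of \<open>h\<close>.\<close>
    define u where "u C = Inf (C \<inter> P)" for C
    define v where "v C = Sup (C \<inter> P)" for C
    have C: "\<exists>p q. C = {p..q} \<and> \<alpha> \<le> p \<and> p \<le> q \<and> q \<le> \<beta>" if Cd: "C \<in> d" for C
    proof -
      obtain p q where pq: "C = {p..q}" using dD(4)[OF Cd] by (metis box_real(2))
      then have "p \<le> q" using dD(3)[OF Cd] by simp
      then show ?thesis using dD(2)[OF Cd] pq by auto
    qed
    have d'd: "C \<in> d" if "C \<in> d'" for C using that by (simp add: d'_def)
    have uv: "u C \<in> C \<inter> P" "v C \<in> C \<inter> P" "u C \<le> v C" "\<And>x. x \<in> C \<inter> P \<Longrightarrow> u C \<le> x \<and> x \<le> v C"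
      if Cd: "C \<in> d'" for C
    proof -
      obtain p q where pq: "C = {p..q}" using C[OF d'd[OF Cd]] by blast
      have cl: "closed (C \<inter> P)" using pq cP by auto
      have ne: "C \<inter> P \<noteq> {}" using Cd by (simp add: d'_def)
      have bd: "bdd_above (C \<inter> P)" "bdd_below (C \<inter> P)"
        using pq by (auto intro: bdd_above_mono[of "{p..q}"] bdd_below_mono[of "{p..q}"])
      show "u C \<in> C \<inter> P" unfolding u_def by (rule closed_contains_Inf[OF ne bd(2) cl])
      show "v C \<in> C \<inter> P" unfolding v_def by (rule closed_contains_Sup[OF ne bd(1) cl])
      show *: "u C \<le> x \<and> x \<le> v C" if "x \<in> C \<inter> P" for x
        unfolding u_def v_def using cInf_lower[OF that bd(2)] cSup_upper[OF that bd(1)] by simp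
      show "u C \<le> v C" using *[OF \<open>u C \<in> C \<inter> P\<close>] by simp
    qed
    have sep: "v C \<le> u D \<or> v D \<le> u C" if CD: "C \<in> d'" "D \<in> d'" "C \<noteq> D" for C D
    proof -
      obtain p q where pq: "C = {p..q}" using C[OF d'd[OF CD(1)]] by blast
      obtain p' q' where pq': "D = {p'..q'}" using C[OF d'd[OF CD(2)]] by blast
      have "interior C \<inter> interior D = {}" using dD(5)[of C D] CD by (auto simp: d'_def)
      then have "{p<..<q} \<inter> {p'<..<q'} = {}" unfolding pq pq' interior_atLeastAtMost_real .
      moreover have "p < q" "p' < q'"
        using CD(1,2) pq pq' by (auto simp: d'_def interior_atLeastAtMost_real)
      ultimately have "q \<le> p' \<or> q' \<le> p" by (auto simp: max_def min_def split: if_splits)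
      then show ?thesis using uv(1,2,3)[OF CD(1)] uv(1,2,3)[OF CD(2)] unfolding pq pq' by auto
    qed
    have zero: "integral C h = 0" if Cd: "C \<in> d - d'" for C
    proof -
      obtain p q where pq: "C = {p..q}" "\<alpha> \<le> p" "q \<le> \<beta>" using C Cd by blast
      have "C \<inter> P = {} \<or> q \<le> p"
        using Cd pq by (auto simp: d'_def interior_atLeastAtMost_real not_less)
      then have "(h has_integral 0) {p..q}" using pq by (intro h0) auto
      then show ?thesis using pq by auto
    qed
    have Ch: "\<bar>integral C h\<bar> \<le> \<bar>integral {u C..v C} f\<bar> + (\<Sum>m. \<bar>J (u C) (v C) m\<bar>)" if Cd: "C \<in> d'" for C
    proof -
      obtain p q where pq: "C = {p..q}" "\<alpha> \<le> p" "q \<le> \<beta>" using C[OF d'd[OF Cd]] by blast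
      have in1: "p \<le> u C" "u C \<le> v C" "v C \<le> q" using uv(1-3)[OF Cd] pq by auto
      have 1: "(h has_integral 0) {p..u C}"
        using uv(4)[OF Cd] in1 pq by (intro h0) (auto, smt (verit))
      have 3: "(h has_integral 0) {v C..q}"
        using uv(4)[OF Cd] in1 pq by (intro h0) (auto, smt (verit))
      have 2: "(h has_integral (integral {u C..v C} f - suminf (J (u C) (v C)))) {u C..v C}"
        using in1 pq by (intro hint) auto
      have "(h has_integral (0 + (integral {u C..v C} f - suminf (J (u C) (v C))))) {p..v C}"
        by (rule has_integral_combine[OF _ _ 1 2]) (use in1 in auto)
      then have "(h has_integral (0 + (integral {u C..v C} f - suminf (J (u C) (v C))) + 0)) {p..q}"
        by (rule has_integral_combine[OF _ _ _ 3, rotated 2]) (use in1 in auto)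
      then have "integral C h = integral {u C..v C} f - suminf (J (u C) (v C))"
        using pq by (auto dest: integral_unique)
      moreover have "\<bar>suminf (J (u C) (v C))\<bar> \<le> (\<Sum>m. \<bar>J (u C) (v C) m\<bar>)"
        by (rule summable_rabs[OF sJ])
      ultimately show ?thesis by linarith
    qed
    have "(\<Sum>C\<in>d. norm (integral C h)) = (\<Sum>C\<in>d'. norm (integral C h))"
      using fin zero by (intro sum.mono_neutral_right) (auto simp: d'_def)
    also have "\<dots> \<le> (\<Sum>C\<in>d'. \<bar>integral {u C..v C} f\<bar> + (\<Sum>m. \<bar>J (u C) (v C) m\<bar>))"
      using Ch by (intro sum_mono) simp
    \<comment> \<open>Exchanging the sums lets each gap be treated separately, and a gap is covered
      by at most one hull.\<close>
    also have "\<dots> = (\<Sum>C\<in>d'. \<bar>integral {u C..v C} f\<bar>) + (\<Sum>m. \<Sum>C\<in>d'. \<bar>J (u C) (v C) m\<bar>)"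
      using suminf_sum[of d' "\<lambda>C m. \<bar>J (u C) (v C) m\<bar>"] sJ by (simp add: sum.distrib)
    also have "\<dots> \<le> K + suminf B"
    proof (rule add_mono)
      show "(\<Sum>C\<in>d'. \<bar>integral {u C..v C} f\<bar>) \<le> K"
      proof (rule endpoint_variation_le_indexed[OF K fin(2)])
        fix D assume D: "D \<in> d'"
        obtain p q where "D = {p..q}" "\<alpha> \<le> p" "q \<le> \<beta>" using C[OF d'd[OF D]] by blast
        then show "\<alpha> \<le> u D \<and> u D \<le> v D \<and> v D \<le> \<beta> \<and> (u D \<in> P \<or> v D \<in> P)"
          using uv(1-3)[OF D] by auto
      qed (rule sep)
      show "(\<Sum>m. \<Sum>C\<in>d'. \<bar>J (u C) (v C) m\<bar>) \<le> suminf B"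
      proof (rule suminf_le)
        fix m
        show "(\<Sum>C\<in>d'. \<bar>J (u C) (v C) m\<bar>) \<le> B m"
          unfolding J_def
        proof (rule sum_integral_gaps_between_endpoints_le[OF sep])
          have "{l m<..<r m} \<inter> P = {}" using U by blast
          then show "u D \<notin> {l m<..<r m} \<and> v D \<notin> {l m<..<r m}" if "D \<in> d'" for D
            using uv(1,2)[OF that] by blast
        qed (use B' in auto)
      qed (use sJ B in \<open>auto intro!: summable_sum\<close>)
    qed
    finally show ?thesis .
  qed
  have "h integrable_on cbox \<alpha> \<beta>" using hint[of \<alpha> \<beta>] by auto
  then have "h absolutely_integrable_on cbox \<alpha> \<beta>"
    by (rule bounded_variation_absolutely_integrable_interval[OF _ bv])
  then have "(\<lambda>x. \<bar>h x\<bar>) integrable_on {\<alpha>..\<beta>}"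
    by (simp add: absolutely_integrable_on_def)
  then obtain R where "((\<lambda>x. \<bar>h x\<bar>) has_integral R) {\<alpha>..\<beta>}" by blast
  then have "((\<lambda>x. if x \<in> {\<alpha>..\<beta>} then \<bar>h x\<bar> else 0) has_integral R) UNIV"
    by (simp only: has_integral_restrict_UNIV)
  moreover have "(\<lambda>x. if x \<in> {\<alpha>..\<beta>} then \<bar>h x\<bar> else 0) = (\<lambda>x. \<bar>h x\<bar>)"
    by (auto simp: h_def)
  ultimately have "((\<lambda>x. \<bar>h x\<bar>) has_integral R) UNIV" by simp
  then have "(\<integral>\<^sup>+x. ennreal \<bar>h x\<bar> \<partial>lebesgue) = ennreal R"
    by (subst (asm) has_integral_iff_nn_integral_lebesgue) auto
  then show ?thesis by (simp add: h_def V_def)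
qed

section \<open>Boundedness of the integral functionals\<close>

lemma Baire_countable_closed_cover:
  fixes \<G> :: "'a::banach set set"
  assumes "countable \<G>" "\<And>T. T \<in> \<G> \<Longrightarrow> closed T" "\<Union>\<G> = UNIV"
  obtains T where "T \<in> \<G>" "interior T \<noteq> {}"
proof (rule ccontr)
  assume "\<not> thesis"
  then have "\<And>T. T \<in> \<G> \<Longrightarrow> interior T = {}" using that by blast
  moreover have "Met_TC.mcomplete TYPE('a)" by (simp add: complete_UNIV)
  ultimately have "interior (\<Union>\<G>) = {}"
    using Met_TC.metric_Baire_category_alt[of \<G>] assms by simp
  then show False using assms(3) by simp
qed

text \<open>By Fatou's lemma the integral is lower semicontinuous in \<open>y\<close>, so its
  sublevel sets are closed.\<close>

lemma closed_nn_integral_le: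
  fixes f :: "'a::metric_space \<Rightarrow> real \<Rightarrow> real"
  assumes meas: "\<And>y. f y \<in> borel_measurable M"
    and cont: "\<And>x. continuous_on UNIV (\<lambda>y. f y x)"
  shows "closed {y. (\<integral>\<^sup>+x. ennreal \<bar>f y x\<bar> \<partial>M) \<le> C}"
  unfolding closed_sequential_limits
proof (intro allI impI, elim conjE)
  fix Y y assume Y: "\<forall>n. Y n \<in> {y. (\<integral>\<^sup>+x. ennreal \<bar>f y x\<bar> \<partial>M) \<le> C}" and lim: "Y \<longlonglongrightarrow> y"
  have "(\<lambda>n. ennreal \<bar>f (Y n) x\<bar>) \<longlonglongrightarrow> ennreal \<bar>f y x\<bar>" for x
    by (intro tendsto_ennrealI tendsto_rabs continuous_on_tendsto_compose[OF cont lim]) auto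
  then have "(\<integral>\<^sup>+x. ennreal \<bar>f y x\<bar> \<partial>M) = (\<integral>\<^sup>+x. liminf (\<lambda>n. ennreal \<bar>f (Y n) x\<bar>) \<partial>M)"
    by (intro nn_integral_cong lim_imp_Liminf[symmetric]) auto
  also have "\<dots> \<le> liminf (\<lambda>n. \<integral>\<^sup>+x. ennreal \<bar>f (Y n) x\<bar> \<partial>M)"
    using meas by (intro nn_integral_liminf) measurable
  also have "\<dots> \<le> liminf (\<lambda>_. C)"
    using Y by (intro Liminf_mono always_eventually) auto
  also have "\<dots> = C" by (simp add: Liminf_const)
  finally show "y \<in> {y. (\<integral>\<^sup>+x. ennreal \<bar>f y x\<bar> \<partial>M) \<le> C}" by simp
qed

text \<open>Rescaling \<open>y\<close> to a vector \<open>z\<close> of norm \<open>r / 2\<close>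
  keeps \<open>y0 + z\<close> in the ball, and \<open>F z\<close>, the difference of
  \<open>F (y0 + z)\<close> and \<open>F y0\<close>, is at most \<open>2 * C\<close> in absolute
  value.\<close>

lemma bounded_linear_if_bounded_on_ball:
  fixes F :: "'a::real_normed_vector \<Rightarrow> real"
  assumes lin: "linear F" and r: "0 < r" and le: "\<And>y. y \<in> ball y0 r \<Longrightarrow> \<bar>F y\<bar> \<le> C"
  shows "bounded_linear F"
proof -
  have C: "\<bar>F y0\<bar> \<le> C" using r by (intro le) simp
  have "norm (F y) \<le> norm y * (2 * C * 2 / r)" for y
  proof (cases "y = 0")
    case True then show ?thesis using linear_0[OF lin] by simp
  next
    case False
    define z where "z = (r / 2 / norm y) *\<^sub>R y"
    have "norm z = r / 2" using False r by (simp add: z_def)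
    then have "\<bar>F (y0 + z)\<bar> \<le> C" using r by (intro le) (simp add: dist_norm)
    moreover have "F (y0 + z) = F y0 + r / 2 / norm y * F y"
      by (simp add: linear_add[OF lin] z_def linear_scale[OF lin])
    ultimately have "\<bar>r / 2 / norm y * F y\<bar> \<le> 2 * C" using C by linarith
    then show ?thesis using r False by (simp add: abs_mult field_simps)
  qed
  then show ?thesis
    using lin by (intro bounded_linear.intro bounded_linear_axioms.intro) blast+
qed

section \<open>The functionals obtained by integrating over intervals\<close>

context
  fixes g :: "real \<Rightarrow> ('a::banach \<Rightarrow>\<^sub>L real)"
  assumes int: "\<And>y c d. (\<lambda>t. g t y) integrable_on {c..d}"
begin

lemma linear_integral_blinfun: "linear (\<lambda>y. integral {c..d} (\<lambda>t. g t y))"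
  by (rule linearI)
    (auto simp: blinfun.add_right blinfun.scaleR_right int intro!: integral_add)

text \<open>For a fixed finite choice of intervals inside the gaps the sum is continuous in
  \<open>y\<close>, since these functionals are bounded; the set is an intersection of the resulting
  closed sets.\<close>

lemma closed_gap_variation_le:
  assumes bl: "\<And>m c d. {c..d} \<subseteq> {l m<..<r m} \<Longrightarrow> bounded_linear (\<lambda>y. integral {c..d} (\<lambda>t. g t y))"
  shows "closed {y. gap_variation_le (\<lambda>t. g t y) l r k}"
proof -
  have "{y. gap_variation_le (\<lambda>t. g t y) l r k} =
      (\<Inter>(M, c, d)\<in>{(M, c, d). \<forall>m<M. {c m..d m} \<subseteq> {l m<..<r m}}.
        {y. (\<Sum>m<M. \<bar>integral {c m..d m} (\<lambda>t. g t y)\<bar>) \<le> k})"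
    by (auto simp: gap_variation_le_def)
  also have "closed \<dots>"
  proof (intro closed_INT ballI, clarify)
    fix M :: nat and c d :: "nat \<Rightarrow> real"
    assume cd: "\<forall>m<M. {c m..d m} \<subseteq> {l m<..<r m}"
    have "continuous_on UNIV (\<lambda>y. \<Sum>m<M. \<bar>integral {c m..d m} (\<lambda>t. g t y)\<bar>)"
      using cd by (intro continuous_on_sum continuous_on_rabs linear_continuous_on bl) auto
    then show "closed {y. (\<Sum>m<M. \<bar>integral {c m..d m} (\<lambda>t. g t y)\<bar>) \<le> k}"
      by (intro closed_Collect_le continuous_on_const)
  qed
  finally show ?thesis .
qed

theorem bounded_linear_integral_blinfun:
  assumes supp: "\<And>t. t \<notin> {a..b} \<Longrightarrow> g t = 0"
  shows "bounded_linear (\<lambda>y. integral {c..d} (\<lambda>t. g t y))"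
proof -
  define BL where "BL c d = bounded_linear (\<lambda>y. integral {c..d} (\<lambda>t. g t y))" for c d
  define P where "P = - {t. \<exists>e>0. \<forall>c d. t - e < c \<longrightarrow> d < t + e \<longrightarrow> BL c d}"
  have BL_combine: "BL p s" if "BL p q" "BL q s" "p \<le> q" "q \<le> s" for p q s
  proof -
    have "(\<lambda>y. integral {p..s} (\<lambda>t. g t y)) =
        (\<lambda>y. integral {p..q} (\<lambda>t. g t y) + integral {q..s} (\<lambda>t. g t y))"
      using that int by (simp add: Henstock_Kurzweil_Integration.integral_combine)
    then show ?thesis using that bounded_linear_add by (auto simp: BL_def)
  qed
  \<comment> \<open>Off \<open>P\<close> boundedness holds locally, and it survives concatenation of
    intervals; bisection extends it to every compact interval that avoids \<open>P\<close>.\<close>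
  have BL_outside: "BL p q" if "{p..q} \<inter> P = {}" for p q
  proof (cases "p \<le> q")
    case True
    then show ?thesis
    proof (induction rule: Bolzano)
      case (trans p q s) then show ?case by (rule BL_combine)
    next
      case (local x)
      then have "x \<notin> P" using that by auto
      then obtain e where e: "e > 0" "\<And>c d. x - e < c \<Longrightarrow> d < x + e \<Longrightarrow> BL c d"
        by (auto simp: P_def)
      then show ?case by (intro exI[of _ e]) auto
    qed
  next
    case False
    then show ?thesis by (simp add: BL_def)
  qed
  have closedP: "closed P"
    unfolding P_def
  proof (rule closed_Compl, subst open_dist, clarify)
    fix t e assume e: "e > 0" "\<forall>c d. t - e < c \<longrightarrow> d < t + e \<longrightarrow> BL c d"
    show "\<exists>e'>0. \<forall>s. dist s t < e' \<longrightarrow> s \<in> {t. \<exists>e>0. \<forall>c d. t - e < c \<longrightarrow> d < t + e \<longrightarrow> BL c d}"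
    proof (intro exI[of _ "e / 2"] conjI allI impI CollectI)
      fix s c d assume "dist s t < e / 2" "s - e / 2 < c" "d < s + e / 2"
      then have "t - e < c" "d < t + e" unfolding dist_real_def by linarith+
      then show "BL c d" using e(2) by blast
    qed (use e in auto)
  qed
  have Pab: "P \<subseteq> {a..b}"
  proof
    fix t assume t: "t \<in> P"
    show "t \<in> {a..b}"
    proof (rule ccontr)
      assume "t \<notin> {a..b}"
      then obtain e where e: "e > 0" "ball t e \<subseteq> - {a..b}"
        using open_contains_ball[of "- {a..b}"] open_Compl[OF closed_atLeastAtMost] by blast
      have "BL c d" if "t - e < c" "d < t + e" for c d
      proof -
        have "integral {c..d} (\<lambda>t. g t y) = integral {c..d} (\<lambda>_. 0)" for y
        proof (rule integral_cong)
          fix s assume "s \<in> {c..d}"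
          then have "s \<in> ball t e" using that by (auto simp: dist_real_def)
          then show "g s y = 0" using supp[of s] e(2) by auto
        qed
        then show ?thesis by (simp add: BL_def)
      qed
      then show False using t e(1) by (auto simp: P_def)
    qed
  qed
  have "P = {}"
  proof (rule ccontr)
    assume Pne: "P \<noteq> {}"
    define gaps where "gaps \<alpha> \<beta> l r \<longleftrightarrow> disjoint_family (\<lambda>m::nat. {l m<..<r m}) \<and>
        {\<alpha><..<\<beta>} - P = (\<Union>m. {l m<..<r m}) \<and>
        (\<forall>m. l m < r m \<longrightarrow> l m \<notin> {\<alpha><..<\<beta>} - P \<and> r m \<notin> {\<alpha><..<\<beta>} - P)" for \<alpha> \<beta> :: real and l r
    have "\<exists>l r. gaps \<alpha> \<beta> l r" for \<alpha> \<beta>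
    proof -
      have "open ({\<alpha><..<\<beta>} - P)" using closedP by (intro open_Diff) auto
      moreover have "bounded ({\<alpha><..<\<beta>} - P)"
        by (rule bounded_subset[of "{\<alpha>..\<beta>}"]) auto
      ultimately show ?thesis
        by (rule bounded_open_real_disjoint_intervals) (auto simp: gaps_def)
    qed
    \<comment> \<open>The decomposition is fixed for each pair \<open>\<alpha>\<close>,
      \<open>\<beta>\<close> independently of \<open>y\<close>, so that
      \<open>Q \<alpha> \<beta> k\<close> refers to the same gaps for all \<open>y\<close>.\<close>
    then obtain l r where gaps: "\<And>\<alpha> \<beta>. gaps \<alpha> \<beta> (l \<alpha> \<beta>) (r \<alpha> \<beta>)" by metis
    define h where "h \<alpha> \<beta> y x = (if x \<in> {\<alpha>..\<beta>} - ({\<alpha><..<\<beta>} - P) then g x y else 0)" for \<alpha> \<beta> x y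
    define Q where "Q \<alpha> \<beta> k = {y. (\<integral>\<^sup>+x. ennreal \<bar>h \<alpha> \<beta> y x\<bar> \<partial>lebesgue) \<le> ennreal (real k)} \<inter>
        {y. gap_variation_le (\<lambda>t. g t y) (l \<alpha> \<beta>) (r \<alpha> \<beta>) (real k)}" for \<alpha> \<beta> and k :: nat
    \<comment> \<open>Rational ends and integer bounds make the family countable. Admitting only
      intervals that meet \<open>P\<close> ensures that the member with interior points leads to a
      contradiction.\<close>
    define \<G> where "\<G> = (\<lambda>(\<alpha>, \<beta>, k). Q \<alpha> \<beta> k) ` {(\<alpha>, \<beta>, k). \<alpha> \<in> \<rat> \<and> \<beta> \<in> \<rat> \<and> P \<inter> {\<alpha><..<\<beta>} \<noteq> {}}"
    have cntG: "countable \<G>"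
    proof -
      have "countable (\<rat> \<times> \<rat> \<times> (UNIV :: nat set) :: (real \<times> real \<times> nat) set)"
        by (intro countable_SIGMA countable_rat) auto
      then show ?thesis unfolding \<G>_def
        by (intro countable_image) (erule countable_subset[rotated], auto)
    qed
    have clQ: "closed (Q \<alpha> \<beta> k)" for \<alpha> \<beta> k
      unfolding Q_def
    proof (intro closed_Int)
      have hm: "h \<alpha> \<beta> y \<in> borel_measurable lebesgue" for y
      proof -
        let ?f = "\<lambda>x. if x \<in> {\<alpha>..\<beta>} then g x y else 0"
        have "?f integrable_on UNIV" using int[of y \<alpha> \<beta>] by (simp only: integrable_restrict_UNIV)
        then have 1: "?f \<in> borel_measurable lebesgue"
          using integrable_imp_measurable lebesgue_on_UNIV_eq by metis
        have "{\<alpha>..\<beta>} - ({\<alpha><..<\<beta>} - P) \<in> sets borel" using closedP by auto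
        then have 2: "{\<alpha>..\<beta>} - ({\<alpha><..<\<beta>} - P) \<in> sets lebesgue" by auto
        have "h \<alpha> \<beta> y = (\<lambda>x. if x \<in> {\<alpha>..\<beta>} - ({\<alpha><..<\<beta>} - P) then ?f x else 0)"
          by (auto simp: h_def)
        moreover have "\<dots> \<in> borel_measurable lebesgue"
          by (rule measurable_If_set[OF 1]) (use 2 in auto)
        ultimately show ?thesis by simp
      qed
      show "closed {y. (\<integral>\<^sup>+x. ennreal \<bar>h \<alpha> \<beta> y x\<bar> \<partial>lebesgue) \<le> ennreal (real k)}"
      proof (rule closed_nn_integral_le[OF hm])
        show "continuous_on UNIV (\<lambda>y. h \<alpha> \<beta> y x)" for x
          by (cases "x \<in> {\<alpha>..\<beta>} - ({\<alpha><..<\<beta>} - P)") (simp_all only: h_def if_True if_False, auto intro!: continuous_intros)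
      qed
      show "closed {y. gap_variation_le (\<lambda>t. g t y) (l \<alpha> \<beta>) (r \<alpha> \<beta>) (real k)}"
      proof (rule closed_gap_variation_le)
        fix m c d assume "{c..d} \<subseteq> {l \<alpha> \<beta> m<..<r \<alpha> \<beta> m}"
        \<comment> \<open>Intervals inside a gap avoid \<open>P\<close>, so their functionals are
          already known to be bounded.\<close>
        moreover have "{l \<alpha> \<beta> m<..<r \<alpha> \<beta> m} \<inter> P = {}" using gaps[of \<alpha> \<beta>] unfolding gaps_def by blast
        ultimately have "BL c d" by (intro BL_outside) blast
        then show "bounded_linear (\<lambda>y. integral {c..d} (\<lambda>t. g t y))" by (simp add: BL_def)
      qed
    qed
    have cover: "\<Union>\<G> = UNIV"
    proof (intro set_eqI iffI UNIV_I)
      fix y :: 'a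
      obtain \<alpha> \<beta> K where ab: "\<alpha> \<in> \<rat>" "\<beta> \<in> \<rat>" "P \<inter> {\<alpha><..<\<beta>} \<noteq> {}"
        and K: "endpoint_variation_le (\<lambda>t. g t y) P \<alpha> \<beta> K"
        by (rule exists_portion_endpoint_variation_le[OF int closedP Pne Pab])
      note G = gaps[of \<alpha> \<beta>, unfolded gaps_def]
      have gv: "gap_variation_le (\<lambda>t. g t y) (l \<alpha> \<beta>) (r \<alpha> \<beta>) (2 * K)"
        by (rule gap_variation_le_of_endpoint_variation[OF int ab(3) K]) (use G in blast)+
      have "(\<integral>\<^sup>+x. ennreal \<bar>h \<alpha> \<beta> y x\<bar> \<partial>lebesgue) < \<infinity>"
        unfolding h_def by (rule nn_integral_portion_finite[OF int closedP K _ _ gv]) (use G in blast)+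
      then obtain R where R: "0 \<le> R" "(\<integral>\<^sup>+x. ennreal \<bar>h \<alpha> \<beta> y x\<bar> \<partial>lebesgue) = ennreal R"
        by (cases "\<integral>\<^sup>+x. ennreal \<bar>h \<alpha> \<beta> y x\<bar> \<partial>lebesgue") auto
      obtain k :: nat where k: "max R (2 * K) \<le> real k" using real_arch_simple by blast
      have "gap_variation_le (\<lambda>t. g t y) (l \<alpha> \<beta>) (r \<alpha> \<beta>) (real k)"
        using gv k unfolding gap_variation_le_def by (meson max.boundedE order_trans)
      then have "y \<in> Q \<alpha> \<beta> k" using R k by (simp add: Q_def ennreal_leI)
      then show "y \<in> \<Union>\<G>" unfolding \<G>_def using ab by fast
    qed
    have "closed T" if "T \<in> \<G>" for T using that clQ by (auto simp: \<G>_def)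
    then obtain T where "T \<in> \<G>" "interior T \<noteq> {}"
      by (rule Baire_countable_closed_cover[OF cntG _ cover])
    then obtain \<alpha> \<beta> k where ne: "P \<inter> {\<alpha><..<\<beta>} \<noteq> {}" and Q: "interior (Q \<alpha> \<beta> k) \<noteq> {}"
      by (auto simp: \<G>_def)
    then obtain y0 e where ball: "e > 0" "ball y0 e \<subseteq> Q \<alpha> \<beta> k" by (auto simp: mem_interior)
    note G = gaps[of \<alpha> \<beta>, unfolded gaps_def]
    \<comment> \<open>On the ball both conditions defining \<open>Q \<alpha> \<beta> k\<close> hold
      with one \<open>k\<close>, which gives the uniform bound \<open>3 * real k\<close> for every
      subinterval.\<close>
    have BL: "BL c d" if "{c..d} \<subseteq> {\<alpha>..\<beta>}" for c d
      unfolding BL_def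
    proof (rule bounded_linear_if_bounded_on_ball[OF linear_integral_blinfun ball(1)])
      fix y assume "y \<in> ball y0 e"
      then have y: "y \<in> Q \<alpha> \<beta> k" using ball by blast
      show "\<bar>integral {c..d} (\<lambda>t. g t y)\<bar> \<le> 3 * real k"
        by (rule abs_integral_le_of_gap_variation[where \<alpha> = \<alpha> and \<beta> = \<beta> and l = "l \<alpha> \<beta>" and r = "r \<alpha> \<beta>"
              and U = "{\<alpha><..<\<beta>} - P"])
          (use int G y that in \<open>auto simp: Q_def h_def\<close>)
    qed
    obtain x where x: "x \<in> P" "\<alpha> < x" "x < \<beta>" using ne by auto
    have "\<exists>e>0. \<forall>c d. x - e < c \<longrightarrow> d < x + e \<longrightarrow> BL c d"
    \<comment> \<open>This radius keeps the intervals inside \<open>{\<alpha>..\<beta>}\<close>, so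
      \<open>x\<close> would be a good point.\<close>
    proof (intro exI[of _ "min (x - \<alpha>) (\<beta> - x)"] conjI allI impI)
      show "BL c d" if "x - min (x - \<alpha>) (\<beta> - x) < c" "d < x + min (x - \<alpha>) (\<beta> - x)" for c d
        by (rule BL) (use that in auto)
    qed (use x in auto)
    then show False using x(1) by (simp add: P_def)
  qed
  then show ?thesis using BL_outside[of c d] by (simp add: BL_def)
qed

end

section \<open>Deduction of Henstock-Gel'fand integrability\<close>

theorem theorem2p1:
  fixes g :: "real \<Rightarrow> ('a::banach \<Rightarrow>\<^sub>L real)" and a b :: real
  shows "henstock_gelfand_integrable g a b \<longleftrightarrow>
           (\<forall>y. (\<lambda>t. blinfun_apply (g t) y) integrable_on {a..b})"
proof
  assume "henstock_gelfand_integrable g a b"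
  then show "\<forall>y. (\<lambda>t. blinfun_apply (g t) y) integrable_on {a..b}"
    by (simp add: henstock_gelfand_integrable_def)
next
  assume int: "\<forall>y. (\<lambda>t. blinfun_apply (g t) y) integrable_on {a..b}"
  \<comment> \<open>Extension by zero gives integrability on every interval and the required
    support, without changing integrals over subintervals of \<open>{a..b}\<close>.\<close>
  define g0 where "g0 t = (if t \<in> {a..b} then g t else 0)" for t
  have g0: "(\<lambda>t. blinfun_apply (g0 t) y) = (\<lambda>t. if t \<in> {a..b} then blinfun_apply (g t) y else 0)" for y
    by (auto simp: g0_def)
  have int0: "(\<lambda>t. blinfun_apply (g0 t) y) integrable_on {c..d}" for y c d
  proof -
    have "(\<lambda>t. blinfun_apply (g0 t) y) integrable_on UNIV"
      using int unfolding g0 by (simp only: integrable_restrict_UNIV)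
    then show ?thesis by (rule integrable_on_subinterval) simp
  qed
  show "henstock_gelfand_integrable g a b"
    unfolding henstock_gelfand_integrable_def
  proof (intro conjI allI impI)
    show "(\<lambda>t. blinfun_apply (g t) y) integrable_on {a..b}" for y using int by blast
    fix c d assume cd: "{c..d} \<subseteq> {a..b}"
    have "bounded_linear (\<lambda>y. integral {c..d} (\<lambda>t. blinfun_apply (g0 t) y))"
      by (rule bounded_linear_integral_blinfun[OF int0, of a b]) (auto simp: g0_def)
    moreover have "integral {c..d} (\<lambda>t. blinfun_apply (g0 t) y) = integral {c..d} (\<lambda>t. blinfun_apply (g t) y)" for y
      using cd by (intro integral_cong) (auto simp: g0_def)
    ultimately have "bounded_linear (\<lambda>y. integral {c..d} (\<lambda>t. blinfun_apply (g t) y))" by simp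
    then show "\<exists>yI :: 'a \<Rightarrow>\<^sub>L real. \<forall>y. blinfun_apply yI y = integral {c..d} (\<lambda>t. blinfun_apply (g t) y)"
      by (metis bounded_linear_Blinfun_apply)
  qed
qed

end
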